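(* Let $x=(\mathbf{B}_t)_{t\in J}\in\mathcal{T}$ be an orthogonal TTN-parameter (for a fixed dimension tree $T$ and fixed dimensions $(k_t)_{t\in T}$). The subspace $$H_x^\times\mathcal{T}=\left\{(\delta\mathbf{B}_t)_{t\in J}\in T_x\mathcal{T}:\ \begin{aligned}&\delta B_{t_L}^TB_{t_L}-\mathbf{B}_t^{(1)}(\delta\mathbf{B}_t^{(1)})^T\\ &\delta B_{t_R}^TB_{t_R}-\mathbf{B}_t^{(2)}(\delta\mathbf{B}_t^{(2)})^T\end{aligned}\ \text{ are symmetric for all } t\in J\setminus L\right\}$$ (where the first, respectively second, condition at $t$ is imposed whenever the child $t_L$, respectively $t_R$, is an internal node) is the orthogonal complement of the vertical space $V_x\mathcal{T}$ in $T_x\mathcal{T}$ with respect to the Euclidean metric $\langle\xi_x,\eta_x\rangle=\sum_{t\in J}\langle\delta\mathbf{B}_t,\delta\mathbf{C}_t\rangle$ for $\xi_x=(\delta\mathbf{B}_t)$, $\eta_x=(\delta\mathbf{C}_t)$.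
   Context: Dimension tree: for $D=\{1,\dots,d\}$, $T$ is a non-trivial rooted binary tree whose nodes are labeled by subsets of $D$; the root is $t_B=D$; the external nodes (leaves) are $E=\{\{i\}:i\in D\}$; each internal node $t\in J=T\setminus E$ has two children $t_L,t_R$ with $t_L\cup t_R=t$ and $\mu<\nu$ for all $\mu\in t_L,\nu\in t_R$. Put $J^-=J\setminus\{t_B\}$, $E^+=E\cup\{t_B\}$, $L=\{t\in T:|t|=2\}$. Positive integers $(k_t)_{t\in T}$ are fixed. TTN-parameters are elements $x=(\mathbf{B}_t)_{t\in J}$ of the Euclidean space $\mathcal{E}=\prod_{t\in J}\mathbb{R}^{k_{t_L}\times k_{t_R}\times k_t}$. For an order-3 tensor $\mathbf{B}$, $\mathbf{B}^{(1)}$ and $\mathbf{B}^{(2)}$ denote the matricizations with rows indexed by the first, respectively second, index and columns by the remaining two indices; $\mathbf{B}^{(1,2)}$ has rows indexed by the first two indices and columns by the third. Write $B_t=\mathbf{B}_t^{(1,2)}\in\mathbb{R}^{k_{t_L}k_{t_R}\times k_t}$ and $\delta B_t=\delta\mathbf{B}_t^{(1,2)}$. $A\times_k\mathbf{B}$ denotes multiplication of $\mathbf{B}$ by the matrix $A$ in the $k$-th mode, and $(A_1\otimes A_2\otimes A_3)\mathbf{B}=A_1\times_1 A_2\times_2 A_3\times_3\mathbf{B}$. $\langle\cdot,\cdot\rangle$ is the entrywise Euclidean inner product. $x$ is full rank if $\mathbf{B}_t^{(1,2)}$ has full column rank $k_t$ for all $t\in J^-$ and $\mathbf{B}_t^{(1)},\mathbf{B}_t^{(2)}$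 have full rank for all $t\in J\setminus L$; $\mathcal{E}^*$ is the set of full-rank parameters. $\mathcal{T}=\{x\in\mathcal{E}^*:B_t^TB_t=I_{k_t}\ \forall t\in J^-\}$ is the set of orthogonal parameters, an embedded submanifold of $\mathcal{E}$ with tangent space $T_x\mathcal{T}=\{(\delta\mathbf{B}_t)_{t\in J}\in\mathcal{E}: B_t^T\delta B_t+\delta B_t^TB_t=0\ \forall t\in J^-\}$. The Lie group $\mathcal{G}=\{\mathcal{A}=(A_t)_{t\in J^-}:A_t\in \mathrm{O}(k_t)\}$ acts on $\mathcal{T}$ by $\theta(x,\mathcal{A})=((A_{t_L}^T\otimes A_{t_R}^T\otimes A_t^T)\mathbf{B}_t)_{t\in J}$, with $A_t=I_{k_t}$ for $t\in E^+$. The vertical space $V_x\mathcal{T}$ is the tangent space at $x$ of the orbit $\{\theta(x,\mathcal{A}):\mathcal{A}\in\mathcal{G}\}$; explicitly, it consists of all $(\delta\mathbf{B}_t)_{t\in J}$ with $\delta\mathbf{B}_t=-G_{t_L}\times_1\mathbf{B}_t-G_{t_R}\times_2\mathbf{B}_t+G_t^T\times_3\mathbf{B}_t$ for all $t\in J$, where $G_t\in\mathbb{R}^{k_t\times k_t}$ is skew-symmetric for $t\in J^-$ and $G_t=0$ for $t\in E^+$. *)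

theory Defs
  imports Complex_Main "HOL-Library.FuncSet" "Jordan_Normal_Form.DL_Rank"
begin

section \<open>Dimension trees\<close>

text \<open>Nodes are identified with their labels, which are pairwise distinct subsets of
  \<open>D = {1..d}\<close>. The functions \<open>lchild\<close> and \<open>rchild\<close> matter on internal nodes only.\<close>

record dim_tree =
  tree_order :: nat
  nodes :: "nat set set"
  lchild :: "nat set \<Rightarrow> nat set"
  rchild :: "nat set \<Rightarrow> nat set"

definition root_node :: "dim_tree \<Rightarrow> nat set" where
  "root_node \<tau> = {1..tree_order \<tau>}"

definition leaves :: "dim_tree \<Rightarrow> nat set set" where
  "leaves \<tau> = {{i} | i. i \<in> root_node \<tau>}"

definition internal :: "dim_tree \<Rightarrow> nat set set" where
  "internal \<tau> = nodes \<tau> - leaves \<tau>"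

definition internal_minus :: "dim_tree \<Rightarrow> nat set set" where
  "internal_minus \<tau> = internal \<tau> - {root_node \<tau>}"

definition pair_nodes :: "dim_tree \<Rightarrow> nat set set" where
  "pair_nodes \<tau> = {t \<in> nodes \<tau>. card t = 2}"

text \<open>Labels are nonempty because each of them is the union of the leaf labels below it. As the
  labels of two siblings are nonempty and disjoint, children are strictly smaller than their
  parent, so that the unique-parent condition makes every node reachable from the root.\<close>

definition dimension_tree :: "dim_tree \<Rightarrow> bool" where
  "dimension_tree \<tau> \<longleftrightarrow>
     tree_order \<tau> \<ge> 2 \<and>
     nodes \<tau> \<subseteq> Pow (root_node \<tau>) \<and> {} \<notin> nodes \<tau> \<and>
     root_node \<tau> \<in> nodes \<tau> \<and> leaves \<tau> \<subseteq> nodes \<tau> \<and>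
     (\<forall>t\<in>internal \<tau>. lchild \<tau> t \<in> nodes \<tau> \<and> rchild \<tau> t \<in> nodes \<tau> \<and>
        lchild \<tau> t \<union> rchild \<tau> t = t \<and>
        (\<forall>\<mu>\<in>lchild \<tau> t. \<forall>\<nu>\<in>rchild \<tau> t. \<mu> < \<nu>)) \<and>
     (\<forall>t\<in>nodes \<tau> - {root_node \<tau>}.
        \<exists>!p. p \<in> internal \<tau> \<and> (t = lchild \<tau> p \<or> t = rchild \<tau> p))"

section \<open>Tensors of order three\<close>

text \<open>The entries of an \<open>n1 \<times> n2 \<times> n3\<close> tensor are indexed from 0; entries outside
  the index range are zero, so that tensors are determined by their entries.\<close>

type_synonym tensor3 = "nat \<Rightarrow> nat \<Rightarrow> nat \<Rightarrow> real"

definition tensor3_carrier :: "nat \<Rightarrow> nat \<Rightarrow> nat \<Rightarrow> tensor3 set" where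
  "tensor3_carrier n1 n2 n3 =
     {B. \<forall>i j l. \<not> (i < n1 \<and> j < n2 \<and> l < n3) \<longrightarrow> B i j l = 0}"

text \<open>Matricizations; pairs of indices are enumerated lexicographically.\<close>

definition matr1 :: "nat \<Rightarrow> nat \<Rightarrow> nat \<Rightarrow> tensor3 \<Rightarrow> real mat" where
  "matr1 n1 n2 n3 B = mat n1 (n2 * n3) (\<lambda>(i, c). B i (c div n3) (c mod n3))"

definition matr2 :: "nat \<Rightarrow> nat \<Rightarrow> nat \<Rightarrow> tensor3 \<Rightarrow> real mat" where
  "matr2 n1 n2 n3 B = mat n2 (n1 * n3) (\<lambda>(j, c). B (c div n3) j (c mod n3))"

definition matr12 :: "nat \<Rightarrow> nat \<Rightarrow> nat \<Rightarrow> tensor3 \<Rightarrow> real mat" where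
  "matr12 n1 n2 n3 B = mat (n1 * n2) n3 (\<lambda>(r, l). B (r div n2) (r mod n2) l)"

definition mode1 :: "real mat \<Rightarrow> tensor3 \<Rightarrow> tensor3" where
  "mode1 A B = (\<lambda>i j l. if i < dim_row A then \<Sum>p<dim_col A. A $$ (i, p) * B p j l else 0)"

definition mode2 :: "real mat \<Rightarrow> tensor3 \<Rightarrow> tensor3" where
  "mode2 A B = (\<lambda>i j l. if j < dim_row A then \<Sum>p<dim_col A. A $$ (j, p) * B i p l else 0)"

definition mode3 :: "real mat \<Rightarrow> tensor3 \<Rightarrow> tensor3" where
  "mode3 A B = (\<lambda>i j l. if l < dim_row A then \<Sum>p<dim_col A. A $$ (l, p) * B i j p else 0)"

definition multilinear :: "real mat \<Rightarrow> real mat \<Rightarrow> real mat \<Rightarrow> tensor3 \<Rightarrow> tensor3" where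
  "multilinear A1 A2 A3 B = mode1 A1 (mode2 A2 (mode3 A3 B))"

definition full_rank :: "real mat \<Rightarrow> bool" where
  "full_rank A \<longleftrightarrow> vec_space.rank (dim_row A) A = min (dim_row A) (dim_col A)"

definition full_column_rank :: "real mat \<Rightarrow> bool" where
  "full_column_rank A \<longleftrightarrow> vec_space.rank (dim_row A) A = dim_col A"

definition symmetric_matrix :: "real mat \<Rightarrow> bool" where
  "symmetric_matrix A \<longleftrightarrow> transpose_mat A = A"

section \<open>TTN-parameters\<close>

type_synonym ttn = "nat set \<Rightarrow> tensor3"
type_synonym dims = "nat set \<Rightarrow> nat"

text \<open>Families indexed by the internal nodes, extended by zero to all other sets.\<close>

definition ttn_space :: "dim_tree \<Rightarrow> dims \<Rightarrow> ttn set" where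
  "ttn_space \<tau> k =
     {x. (\<forall>t\<in>internal \<tau>. x t \<in> tensor3_carrier (k (lchild \<tau> t)) (k (rchild \<tau> t)) (k t)) \<and>
         (\<forall>t. t \<notin> internal \<tau> \<longrightarrow> x t = (\<lambda>_ _ _. 0))}"

definition node_matr1 :: "dim_tree \<Rightarrow> dims \<Rightarrow> ttn \<Rightarrow> nat set \<Rightarrow> real mat" where
  "node_matr1 \<tau> k x t = matr1 (k (lchild \<tau> t)) (k (rchild \<tau> t)) (k t) (x t)"

definition node_matr2 :: "dim_tree \<Rightarrow> dims \<Rightarrow> ttn \<Rightarrow> nat set \<Rightarrow> real mat" where
  "node_matr2 \<tau> k x t = matr2 (k (lchild \<tau> t)) (k (rchild \<tau> t)) (k t) (x t)"

definition node_matr12 :: "dim_tree \<Rightarrow> dims \<Rightarrow> ttn \<Rightarrow> nat set \<Rightarrow> real mat" where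
  "node_matr12 \<tau> k x t = matr12 (k (lchild \<tau> t)) (k (rchild \<tau> t)) (k t) (x t)"

definition ttn_inner :: "dim_tree \<Rightarrow> dims \<Rightarrow> ttn \<Rightarrow> ttn \<Rightarrow> real" where
  "ttn_inner \<tau> k \<xi> \<eta> =
     (\<Sum>t\<in>internal \<tau>. \<Sum>i<k (lchild \<tau> t). \<Sum>j<k (rchild \<tau> t). \<Sum>l<k t.
        \<xi> t i j l * \<eta> t i j l)"

definition full_rank_ttns :: "dim_tree \<Rightarrow> dims \<Rightarrow> ttn set" where
  "full_rank_ttns \<tau> k =
     {x \<in> ttn_space \<tau> k.
        (\<forall>t\<in>internal_minus \<tau>. full_column_rank (node_matr12 \<tau> k x t)) \<and>
        (\<forall>t\<in>internal \<tau> - pair_nodes \<tau>.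
           full_rank (node_matr1 \<tau> k x t) \<and> full_rank (node_matr2 \<tau> k x t))}"

definition orthogonal_ttns :: "dim_tree \<Rightarrow> dims \<Rightarrow> ttn set" where
  "orthogonal_ttns \<tau> k =
     {x \<in> full_rank_ttns \<tau> k.
        \<forall>t\<in>internal_minus \<tau>.
          transpose_mat (node_matr12 \<tau> k x t) * node_matr12 \<tau> k x t = 1\<^sub>m (k t)}"

text \<open>The tangent space of the manifold \<open>orthogonal_ttns \<tau> k\<close> at \<open>x\<close>.\<close>

definition tangent_orthogonal :: "dim_tree \<Rightarrow> dims \<Rightarrow> ttn \<Rightarrow> ttn set" where
  "tangent_orthogonal \<tau> k x =
     {\<xi> \<in> ttn_space \<tau> k.
        \<forall>t\<in>internal_minus \<tau>.
          transpose_mat (node_matr12 \<tau> k x t) * node_matr12 \<tau> k \<xi> t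
          + transpose_mat (node_matr12 \<tau> k \<xi> t) * node_matr12 \<tau> k x t = 0\<^sub>m (k t) (k t)}"

section \<open>Group action and vertical space\<close>

definition orthogonal_group :: "nat \<Rightarrow> real mat set" where
  "orthogonal_group n = {A \<in> carrier_mat n n. transpose_mat A * A = 1\<^sub>m n}"

definition ttn_group :: "dim_tree \<Rightarrow> dims \<Rightarrow> (nat set \<Rightarrow> real mat) set" where
  "ttn_group \<tau> k = (\<Pi>\<^sub>E t\<in>internal_minus \<tau>. orthogonal_group (k t))"

definition ttn_action ::
    "dim_tree \<Rightarrow> dims \<Rightarrow> ttn \<Rightarrow> (nat set \<Rightarrow> real mat) \<Rightarrow> ttn" where
  "ttn_action \<tau> k x \<A> =
     (let A = (\<lambda>t. if t \<in> internal_minus \<tau> then \<A> t else 1\<^sub>m (k t)) in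
      (\<lambda>t. if t \<in> internal \<tau>
           then multilinear (transpose_mat (A (lchild \<tau> t))) (transpose_mat (A (rchild \<tau> t)))
                  (transpose_mat (A t)) (x t)
           else (\<lambda>_ _ _. 0)))"

definition ttn_orbit :: "dim_tree \<Rightarrow> dims \<Rightarrow> ttn \<Rightarrow> ttn set" where
  "ttn_orbit \<tau> k x = {ttn_action \<tau> k x \<A> | \<A>. \<A> \<in> ttn_group \<tau> k}"

text \<open>The velocities at \<open>x\<close> of the \<open>C\<^sup>1\<close> curves that run in \<open>M\<close>. Since elements of
  \<open>ttn_space\<close> have finitely many nonzero entries at fixed positions, entrywise derivatives are
  derivatives in the Euclidean space \<open>ttn_space \<tau> k\<close>.\<close>

definition tangent_space :: "ttn set \<Rightarrow> ttn \<Rightarrow> ttn set" where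
  "tangent_space M x =
     {\<xi>. \<exists>(\<gamma> :: real \<Rightarrow> ttn) (\<gamma>' :: real \<Rightarrow> ttn) (\<epsilon> :: real).
        \<epsilon> > 0 \<and> \<gamma> 0 = x \<and> \<gamma>' 0 = \<xi> \<and>
        (\<forall>s\<in>{-\<epsilon><..<\<epsilon>}. \<gamma> s \<in> M) \<and>
        (\<forall>t i j l.
           (\<forall>s\<in>{-\<epsilon><..<\<epsilon>}. ((\<lambda>r. \<gamma> r t i j l) has_real_derivative \<gamma>' s t i j l) (at s)) \<and>
           continuous_on {-\<epsilon><..<\<epsilon>} (\<lambda>s. \<gamma>' s t i j l))}"

definition vertical_space :: "dim_tree \<Rightarrow> dims \<Rightarrow> ttn \<Rightarrow> ttn set" where
  "vertical_space \<tau> k x = tangent_space (ttn_orbit \<tau> k x) x"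

definition horizontal_space :: "dim_tree \<Rightarrow> dims \<Rightarrow> ttn \<Rightarrow> ttn set" where
  "horizontal_space \<tau> k x =
     {\<xi> \<in> tangent_orthogonal \<tau> k x.
        \<forall>t\<in>internal \<tau> - pair_nodes \<tau>.
          (lchild \<tau> t \<in> internal \<tau> \<longrightarrow>
             symmetric_matrix
               (transpose_mat (node_matr12 \<tau> k \<xi> (lchild \<tau> t)) * node_matr12 \<tau> k x (lchild \<tau> t)
                - node_matr1 \<tau> k x t * transpose_mat (node_matr1 \<tau> k \<xi> t))) \<and>
          (rchild \<tau> t \<in> internal \<tau> \<longrightarrow>
             symmetric_matrix
               (transpose_mat (node_matr12 \<tau> k \<xi> (rchild \<tau> t)) * node_matr12 \<tau> k x (rchild \<tau> t)
                - node_matr2 \<tau> k x t * transpose_mat (node_matr2 \<tau> k \<xi> t)))}"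

definition orthogonal_complement_in ::
    "dim_tree \<Rightarrow> dims \<Rightarrow> ttn set \<Rightarrow> ttn set \<Rightarrow> ttn set" where
  "orthogonal_complement_in \<tau> k W V = {\<xi> \<in> W. \<forall>\<eta>\<in>V. ttn_inner \<tau> k \<xi> \<eta> = 0}"

end

theory Submission
  imports Defs
begin

text \<open>The orbit map is injective in a way that can be inverted explicitly: as
  \<open>B\<^sub>t\<close> has orthonormal columns, \<open>A\<^sub>t\<close> is recovered from the transformed
  parameter and the \<open>A\<close> of the two children of \<open>t\<close> by
  multiplying with \<open>B\<^sub>t\<^sup>T\<close>. Going up from the leaves, where \<open>A = I\<close>, a differentiable curve in
  the orbit therefore lifts to a differentiable curve in the group, and its velocity at \<open>x\<close> is the
  infinitesimal action of a skew-symmetric family \<open>G\<close>. Conversely, rotations of one coordinate plane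
  at one node realise a basis of these families. The inner product of \<open>\<xi>\<close> with the
  infinitesimal action of \<open>G\<close> is a sum over the nodes \<open>u\<close> of \<open>\<langle>G\<^sub>u, N\<^sub>u\<rangle>\<close>
  (the matrix \<open>N\<^sub>u\<close> is \<open>node_moment\<close>), and the horizontality condition says that every \<open>N\<^sub>u\<close> is symmetric.\<close>

section \<open>Sums and matricizations\<close>

abbreviation kron :: "nat \<Rightarrow> nat \<Rightarrow> real" where
  "kron p q \<equiv> (if p = q then 1 else 0)"

text \<open>Cutting the range into \<open>n\<close> blocks of length \<open>m\<close> makes
  \<open>c div m\<close> the block and \<open>c mod m\<close> the position in it. Matricizations
  enumerate index pairs in this way; for \<open>m = 0\<close> both sides vanish.\<close>

lemma sum_div_mod:
  fixes f :: "nat \<Rightarrow> nat \<Rightarrow> 'a::comm_monoid_add"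
  shows "(\<Sum>c<n * m. f (c div m) (c mod m)) = (\<Sum>a<n. \<Sum>b<m. f a b)"
proof -
  have "(\<Sum>c<n * m. f (c div m) (c mod m))
      = (\<Sum>a<n. \<Sum>c\<in>{a * m..<a * m + m}. f (c div m) (c mod m))"
    by (rule sum.nat_group [symmetric])
  also have "\<dots> = (\<Sum>a<n. \<Sum>b<m. f a b)"
  proof (rule sum.cong [OF refl])
    fix a
    have "(\<Sum>c\<in>{a * m..<a * m + m}. f (c div m) (c mod m))
        = (\<Sum>b\<in>{0..<m}. f ((b + a * m) div m) ((b + a * m) mod m))"
      using sum.shift_bounds_nat_ivl [of "\<lambda>c. f (c div m) (c mod m)" 0 "a * m" m]
      by (simp add: add.commute)
    also have "\<dots> = (\<Sum>b<m. f a b)"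
      by (rule sum.cong) auto
    finally show "(\<Sum>c\<in>{a * m..<a * m + m}. f (c div m) (c mod m)) = (\<Sum>b<m. f a b)" .
  qed
  finally show ?thesis .
qed

section \<open>Products of matricizations, entry by entry\<close>

lemma matr12_gram_entry:
  assumes "p < n3" "q < n3"
  shows "(transpose_mat (matr12 n1 n2 n3 B) * matr12 n1 n2 n3 C) $$ (p, q)
       = (\<Sum>i<n1. \<Sum>j<n2. B i j p * C i j q)"
proof -
  have "(transpose_mat (matr12 n1 n2 n3 B) * matr12 n1 n2 n3 C) $$ (p, q)
      = (\<Sum>c<n1 * n2. B (c div n2) (c mod n2) p * C (c div n2) (c mod n2) q)"
    using assms by (simp add: matr12_def scalar_prod_def atLeast0LessThan)
  then show ?thesis
    by (simp only: sum_div_mod [where f = "\<lambda>i j. B i j p * C i j q"])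
qed

lemma matr1_gram_entry:
  assumes "p < n1" "q < n1"
  shows "(matr1 n1 n2 n3 B * transpose_mat (matr1 n1 n2 n3 C)) $$ (p, q)
       = (\<Sum>j<n2. \<Sum>l<n3. B p j l * C q j l)"
proof -
  have "(matr1 n1 n2 n3 B * transpose_mat (matr1 n1 n2 n3 C)) $$ (p, q)
      = (\<Sum>c<n2 * n3. B p (c div n3) (c mod n3) * C q (c div n3) (c mod n3))"
    using assms by (simp add: matr1_def scalar_prod_def atLeast0LessThan)
  then show ?thesis
    by (simp only: sum_div_mod [where f = "\<lambda>j l. B p j l * C q j l"])
qed

lemma matr2_gram_entry:
  assumes "p < n2" "q < n2"
  shows "(matr2 n1 n2 n3 B * transpose_mat (matr2 n1 n2 n3 C)) $$ (p, q)
       = (\<Sum>i<n1. \<Sum>l<n3. B i p l * C i q l)"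
proof -
  have "(matr2 n1 n2 n3 B * transpose_mat (matr2 n1 n2 n3 C)) $$ (p, q)
      = (\<Sum>c<n1 * n3. B (c div n3) p (c mod n3) * C (c div n3) q (c mod n3))"
    using assms by (simp add: matr2_def scalar_prod_def atLeast0LessThan)
  then show ?thesis
    by (simp only: sum_div_mod [where f = "\<lambda>i l. B i p l * C i q l"])
qed

lemma symmetric_matrix_iff:
  assumes "M \<in> carrier_mat n n"
  shows "symmetric_matrix M \<longleftrightarrow> (\<forall>p<n. \<forall>q<n. M $$ (p, q) = M $$ (q, p))"
  using assms unfolding symmetric_matrix_def by (auto simp: mat_eq_iff)

text \<open>Orthonormal rows mean that \<open>M\<close> undoes its own transpose. In
  \<open>entry_action_recover\<close> this cancels the action in one mode.\<close>

lemma sum_orthonormal_rows_contract: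
  fixes M :: "nat \<Rightarrow> nat \<Rightarrow> real"
  assumes "\<And>i'. i' < n \<Longrightarrow> (\<Sum>p<n. M i p * M i' p) = kron i i'" "i < n"
  shows "(\<Sum>p<n. M i p * (\<Sum>i'<n. M i' p * f i')) = f i"
proof -
  have "(\<Sum>p<n. M i p * (\<Sum>i'<n. M i' p * f i')) = (\<Sum>p<n. \<Sum>i'<n. M i p * M i' p * f i')"
    by (simp add: sum_distrib_left mult.assoc)
  also have "\<dots> = (\<Sum>i'<n. (\<Sum>p<n. M i p * M i' p) * f i')"
    by (subst sum.swap) (simp add: sum_distrib_right)
  also have "\<dots> = (\<Sum>i'<n. kron i i' * f i')"
    using assms(1) by simp
  also have "\<dots> = f i"
    using assms(2) by (simp add: if_distrib [of "\<lambda>c. c * _"] cong: if_cong)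
  finally show ?thesis .
qed

lemma sum_kron_left [simp]:
  "(\<Sum>p<n. kron p i * f p) = (if i < n then f i else 0)"
  "(\<Sum>p<n. kron i p * f p) = (if i < n then f i else 0)"
  by (simp_all add: if_distrib [of "\<lambda>c. c * _"] cong: if_cong)

text \<open>The product rule for a single contraction; the nested sums of
  \<open>entry_action\<close> take one application per mode.\<close>

lemma DERIV_sum_mult:
  fixes M f :: "real \<Rightarrow> nat \<Rightarrow> real"
  assumes "\<And>p. p < n \<Longrightarrow> ((\<lambda>s. M s p) has_real_derivative M' p) (at a)"
    and "\<And>p. p < n \<Longrightarrow> ((\<lambda>s. f s p) has_real_derivative f' p) (at a)"
  shows "((\<lambda>s. \<Sum>p<n. M s p * f s p) has_real_derivative
          (\<Sum>p<n. M' p * f a p + M a p * f' p)) (at a)"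
proof (rule DERIV_sum)
  fix p assume "p \<in> {..<n}"
  then show "((\<lambda>s. M s p * f s p) has_real_derivative (M' p * f a p + M a p * f' p)) (at a)"
    using DERIV_mult [OF assms(1) assms(2), of p p] by (simp add: mult.commute)
qed

text \<open>Exchanging the two summation indices turns the sum into its own negative.\<close>

lemma skew_pairing_symmetric_zero:
  fixes G N :: "nat \<Rightarrow> nat \<Rightarrow> real"
  assumes "\<And>p q. p < n \<Longrightarrow> q < n \<Longrightarrow> G p q = - G q p"
    and "\<And>p q. p < n \<Longrightarrow> q < n \<Longrightarrow> N p q = N q p"
  shows "(\<Sum>p<n. \<Sum>q<n. G p q * N p q) = 0"
proof -
  have "(\<Sum>p<n. \<Sum>q<n. G p q * N p q) = (\<Sum>p<n. \<Sum>q<n. - (G q p * N q p))"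
    by (intro sum.cong refl) (metis assms lessThan_iff mult_minus_left)
  also have "\<dots> = - (\<Sum>q<n. \<Sum>p<n. G q p * N q p)"
    by (subst sum.swap) (simp add: sum_negf)
  finally show ?thesis by simp
qed

section \<open>The orbit map in coordinates\<close>

text \<open>Rows and columns are both recorded: the row relations cancel the action, the column
  relations yield skew-symmetry of velocities.\<close>

definition orthogonal_entries :: "nat \<Rightarrow> (nat \<Rightarrow> nat \<Rightarrow> real) \<Rightarrow> bool" where
  "orthogonal_entries n M \<longleftrightarrow>
     (\<forall>p<n. \<forall>q<n. (\<Sum>r<n. M r p * M r q) = kron p q \<and> (\<Sum>r<n. M p r * M q r) = kron p q)"

lemma orthogonal_entries_of_group:
  assumes "A \<in> orthogonal_group n"
  shows "orthogonal_entries n (\<lambda>p q. A $$ (p, q))"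
proof -
  have A: "A \<in> carrier_mat n n" and 1: "transpose_mat A * A = 1\<^sub>m n"
    using assms by (auto simp: orthogonal_group_def)
  \<comment> \<open>A left inverse of a square matrix is also a right inverse; this supplies the row
    relations.\<close>
  have 2: "A * transpose_mat A = 1\<^sub>m n"
    using mat_mult_left_right_inverse [OF _ A 1] A by simp
  have "(\<Sum>r<n. A $$ (r, p) * A $$ (r, q)) = kron p q \<and>
        (\<Sum>r<n. A $$ (p, r) * A $$ (q, r)) = kron p q" if "p < n" "q < n" for p q
  proof
    have "(transpose_mat A * A) $$ (p, q) = (\<Sum>r<n. A $$ (r, p) * A $$ (r, q))"
      using A that by (simp add: scalar_prod_def atLeast0LessThan)
    then show "(\<Sum>r<n. A $$ (r, p) * A $$ (r, q)) = kron p q"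
      using 1 that by simp
    have "(A * transpose_mat A) $$ (p, q) = (\<Sum>r<n. A $$ (p, r) * A $$ (q, r))"
      using A that by (simp add: scalar_prod_def atLeast0LessThan)
    then show "(\<Sum>r<n. A $$ (p, r) * A $$ (q, r)) = kron p q"
      using 2 that by simp
  qed
  then show ?thesis by (simp add: orthogonal_entries_def)
qed

lemma orthogonal_entries_kron: "orthogonal_entries n kron"
  by (auto simp: orthogonal_entries_def)

definition in_range :: "dim_tree \<Rightarrow> dims \<Rightarrow> nat set \<Rightarrow> nat \<Rightarrow> nat \<Rightarrow> nat \<Rightarrow> bool" where
  "in_range \<tau> k t i j l \<longleftrightarrow>
     t \<in> internal \<tau> \<and> i < k (lchild \<tau> t) \<and> j < k (rchild \<tau> t) \<and> l < k t"

text \<open>Entry functions replace matrices so that curves can be differentiated entry by entry.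
  The summation index comes first in \<open>A\<close> because the action uses transposes.\<close>

definition entry_action ::
    "dim_tree \<Rightarrow> dims \<Rightarrow> ttn \<Rightarrow> (nat set \<Rightarrow> nat \<Rightarrow> nat \<Rightarrow> real) \<Rightarrow> ttn" where
  "entry_action \<tau> k x A t i j l =
     (if in_range \<tau> k t i j l
      then \<Sum>p<k (lchild \<tau> t). A (lchild \<tau> t) p i *
             (\<Sum>q<k (rchild \<tau> t). A (rchild \<tau> t) q j * (\<Sum>r<k t. A t r l * x t p q r))
      else 0)"

text \<open>The Leibniz rule for \<open>entry_action\<close> in direction \<open>G\<close>, in the
  nested form that \<open>DERIV_sum_mult\<close> produces.\<close>

definition entry_action_deriv ::
    "dim_tree \<Rightarrow> dims \<Rightarrow> ttn \<Rightarrow> (nat set \<Rightarrow> nat \<Rightarrow> nat \<Rightarrow> real) \<Rightarrow>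
     (nat set \<Rightarrow> nat \<Rightarrow> nat \<Rightarrow> real) \<Rightarrow> ttn" where
  "entry_action_deriv \<tau> k x A G t i j l =
     (if in_range \<tau> k t i j l
      then \<Sum>p<k (lchild \<tau> t).
             G (lchild \<tau> t) p i *
               (\<Sum>q<k (rchild \<tau> t). A (rchild \<tau> t) q j * (\<Sum>r<k t. A t r l * x t p q r))
           + A (lchild \<tau> t) p i *
               (\<Sum>q<k (rchild \<tau> t).
                  G (rchild \<tau> t) q j * (\<Sum>r<k t. A t r l * x t p q r)
                + A (rchild \<tau> t) q j * (\<Sum>r<k t. G t r l * x t p q r))
      else 0)"

text \<open>For skew-symmetric \<open>G\<close> this is the explicit form of a vertical vector, because
  \<open>\<Sum>\<^sub>p G\<^sub>p\<^sub>i x\<^sub>p\<close> is an entry of \<open>G\<^sup>T \<times>\<^sub>1 x = - G \<times>\<^sub>1 x\<close>.\<close>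

definition infinitesimal_action ::
    "dim_tree \<Rightarrow> dims \<Rightarrow> ttn \<Rightarrow> (nat set \<Rightarrow> nat \<Rightarrow> nat \<Rightarrow> real) \<Rightarrow> ttn" where
  "infinitesimal_action \<tau> k x G t i j l =
     (if in_range \<tau> k t i j l
      then (\<Sum>p<k (lchild \<tau> t). G (lchild \<tau> t) p i * x t p j l)
         + (\<Sum>q<k (rchild \<tau> t). G (rchild \<tau> t) q j * x t i q l)
         + (\<Sum>r<k t. G t r l * x t i j r)
      else 0)"

text \<open>Members of \<open>ttn_group\<close> are \<open>undefined\<close> outside J^-; there the
  identity takes over, matching A_t = I at the leaves and the root.\<close>

definition group_entries ::
    "dim_tree \<Rightarrow> (nat set \<Rightarrow> real mat) \<Rightarrow> nat set \<Rightarrow> nat \<Rightarrow> nat \<Rightarrow> real" where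
  "group_entries \<tau> \<A> t p q = (if t \<in> internal_minus \<tau> then \<A> t $$ (p, q) else kron p q)"

lemma multilinear_entry:
  assumes "A1 \<in> carrier_mat n1 n1" "A2 \<in> carrier_mat n2 n2" "A3 \<in> carrier_mat n3 n3"
  shows "multilinear (transpose_mat A1) (transpose_mat A2) (transpose_mat A3) B i j l =
    (if i < n1 \<and> j < n2 \<and> l < n3
     then \<Sum>p<n1. A1 $$ (p, i) * (\<Sum>q<n2. A2 $$ (q, j) * (\<Sum>r<n3. A3 $$ (r, l) * B p q r))
     else 0)"
  using assms by (auto simp: multilinear_def mode1_def mode2_def mode3_def)

lemma ttn_action_eq_entry_action:
  assumes "\<And>t. t \<in> internal_minus \<tau> \<Longrightarrow> \<A> t \<in> carrier_mat (k t) (k t)"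
  shows "ttn_action \<tau> k x \<A> = entry_action \<tau> k x (group_entries \<tau> \<A>)"
proof (intro ext)
  fix t i j l
  define A where "A = (\<lambda>t. if t \<in> internal_minus \<tau> then \<A> t else 1\<^sub>m (k t))"
  have A: "A t \<in> carrier_mat (k t) (k t)" for t
    using assms by (simp add: A_def)
  have entry: "A t $$ (p, q) = group_entries \<tau> \<A> t p q" if "p < k t" "q < k t" for t p q
    using that by (simp add: A_def group_entries_def)
  show "ttn_action \<tau> k x \<A> t i j l = entry_action \<tau> k x (group_entries \<tau> \<A>) t i j l"
    unfolding ttn_action_def Let_def A_def [symmetric]
    by (simp add: multilinear_entry [OF A A A] entry_action_def in_range_def entry
        cong: sum.cong_simp)
qed

section \<open>Differentiating the orbit map\<close>

lemma DERIV_entry_action: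
  assumes "\<And>t p q. t \<in> nodes \<tau> \<Longrightarrow> p < k t \<Longrightarrow> q < k t \<Longrightarrow>
             ((\<lambda>s. A s t p q) has_real_derivative G t p q) (at a)"
    and "\<And>t. t \<in> internal \<tau> \<Longrightarrow> t \<in> nodes \<tau> \<and> lchild \<tau> t \<in> nodes \<tau> \<and> rchild \<tau> t \<in> nodes \<tau>"
  shows "((\<lambda>s. entry_action \<tau> k x (A s) t i j l) has_real_derivative
           entry_action_deriv \<tau> k x (A a) G t i j l) (at a)"
proof (cases "in_range \<tau> k t i j l")
  case True
  have inner: "((\<lambda>s. \<Sum>r<k t. A s t r l * x t p q r) has_real_derivative
          (\<Sum>r<k t. G t r l * x t p q r)) (at a)" for p q
    using DERIV_sum_mult [of "k t" "\<lambda>s r. A s t r l" "\<lambda>r. G t r l" a "\<lambda>s r. x t p q r" "\<lambda>r. 0"]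
      assms True by (simp add: in_range_def)
  show ?thesis
    using True unfolding entry_action_def entry_action_deriv_def
    by (simp only: if_True) (intro DERIV_sum_mult inner assms(1); simp add: in_range_def assms(2))
next
  case False
  then show ?thesis by (simp add: entry_action_def entry_action_deriv_def)
qed

text \<open>Outside the index ranges the left side is 0 by definition, and \<open>x\<close> vanishes
  there because it lies in \<open>ttn_space\<close>.\<close>

lemma entry_action_kron:
  assumes "x \<in> ttn_space \<tau> k"
  shows "entry_action \<tau> k x (\<lambda>t. kron) = x"
proof (intro ext)
  fix t i j l
  show "entry_action \<tau> k x (\<lambda>t. kron) t i j l = x t i j l"
    using assms
    by (cases "t \<in> internal \<tau>")
      (auto simp: entry_action_def in_range_def ttn_space_def tensor3_carrier_def)
qed

text \<open>A lifted curve is known to start at the identity only at the nodes and inside the ranges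
  \<open>k t\<close>; this still allows its initial value to be replaced by
  \<open>kron\<close>.\<close>

lemma entry_action_deriv_cong:
  assumes "\<And>t p q. t \<in> nodes \<tau> \<Longrightarrow> p < k t \<Longrightarrow> q < k t \<Longrightarrow> A t p q = A' t p q"
    and "\<And>t. t \<in> internal \<tau> \<Longrightarrow> t \<in> nodes \<tau> \<and> lchild \<tau> t \<in> nodes \<tau> \<and> rchild \<tau> t \<in> nodes \<tau>"
  shows "entry_action_deriv \<tau> k x A G = entry_action_deriv \<tau> k x A' G"
proof (intro ext)
  fix t i j l
  show "entry_action_deriv \<tau> k x A G t i j l = entry_action_deriv \<tau> k x A' G t i j l"
    by (auto simp: entry_action_deriv_def in_range_def assms intro!: sum.cong arg_cong2 [of _ _ _ _ "(+)"])
qed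

lemma entry_action_deriv_kron:
  "entry_action_deriv \<tau> k x (\<lambda>t. kron) G = infinitesimal_action \<tau> k x G"
proof (intro ext)
  fix t i j l
  show "entry_action_deriv \<tau> k x (\<lambda>t. kron) G t i j l = infinitesimal_action \<tau> k x G t i j l"
    by (simp add: entry_action_deriv_def infinitesimal_action_def in_range_def sum.distrib
        distrib_left)
qed

section \<open>Dimension trees\<close>

context
  fixes \<tau> :: dim_tree
  assumes tree: "dimension_tree \<tau>"
begin

lemma child_nodes:
  assumes "t \<in> internal \<tau>"
  shows "t \<in> nodes \<tau> \<and> lchild \<tau> t \<in> nodes \<tau> \<and> rchild \<tau> t \<in> nodes \<tau>"
  using assms tree unfolding dimension_tree_def by (auto simp: internal_def)

lemma finite_internal: "finite (internal \<tau>)"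
proof (rule finite_subset)
  show "internal \<tau> \<subseteq> Pow (root_node \<tau>)"
    using tree unfolding dimension_tree_def by (auto simp: internal_def)
qed (simp add: root_node_def)

lemma node_finite_nonempty:
  assumes "t \<in> nodes \<tau>"
  shows "finite t \<and> t \<noteq> {} \<and> t \<subseteq> root_node \<tau>"
proof -
  have "t \<subseteq> root_node \<tau>" "t \<noteq> {}"
    using assms tree unfolding dimension_tree_def by auto
  moreover have "finite (root_node \<tau>)" by (simp add: root_node_def)
  ultimately show ?thesis using finite_subset by blast
qed

section \<open>Sizes and positions of children\<close>

lemma children_partition:
  assumes "t \<in> internal \<tau>"
  shows "lchild \<tau> t \<union> rchild \<tau> t = t" "lchild \<tau> t \<inter> rchild \<tau> t = {}"
proof -
  have un: "lchild \<tau> t \<union> rchild \<tau> t = t"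
    and less: "\<forall>\<mu>\<in>lchild \<tau> t. \<forall>\<nu>\<in>rchild \<tau> t. \<mu> < \<nu>"
    using assms tree unfolding dimension_tree_def by blast+
  show "lchild \<tau> t \<union> rchild \<tau> t = t" by (rule un)
  show "lchild \<tau> t \<inter> rchild \<tau> t = {}" using less by fastforce
qed

lemma children_distinct:
  assumes "t \<in> internal \<tau>"
  shows "lchild \<tau> t \<noteq> rchild \<tau> t"
  using children_partition(2) [OF assms] child_nodes [OF assms] node_finite_nonempty by auto

text \<open>The two children are nonempty and partition \<open>t\<close>. The size of the label is
  the measure for the induction from the leaves upwards.\<close>

lemma card_children:
  assumes "t \<in> internal \<tau>"
  shows "card (lchild \<tau> t) < card t" "card (rchild \<tau> t) < card t"
proof -
  have pos: "0 < card (lchild \<tau> t)" "0 < card (rchild \<tau> t)"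
    using child_nodes [OF assms] node_finite_nonempty by (simp_all add: card_gt_0_iff)
  have "card t = card (lchild \<tau> t) + card (rchild \<tau> t)"
    using card_Un_disjoint [of "lchild \<tau> t" "rchild \<tau> t"] children_partition [OF assms]
      child_nodes [OF assms] node_finite_nonempty by simp
  then show "card (lchild \<tau> t) < card t" "card (rchild \<tau> t) < card t"
    using pos by simp_all
qed

text \<open>A child is smaller than its parent, hence smaller than the root.\<close>

lemma internal_child_minus:
  assumes "t \<in> internal \<tau>" "u = lchild \<tau> t \<or> u = rchild \<tau> t" "u \<in> internal \<tau>"
  shows "u \<in> internal_minus \<tau>"
proof -
  have "card u < card t" using assms card_children by blast
  also have "card t \<le> card (root_node \<tau>)"
    using child_nodes [OF assms(1)] node_finite_nonempty
    by (intro card_mono) (simp_all add: root_node_def)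
  finally show ?thesis using assms(3) by (auto simp: internal_minus_def)
qed

text \<open>A node of size two has only singletons as children, which are leaves. Hence imposing the
  horizontality conditions on J - L alone misses no internal child.\<close>

lemma internal_child_not_pair:
  assumes "t \<in> internal \<tau>" "u = lchild \<tau> t \<or> u = rchild \<tau> t" "u \<in> internal \<tau>"
  shows "t \<notin> pair_nodes \<tau>"
proof
  assume "t \<in> pair_nodes \<tau>"
  then have "card u < 2" using assms(2) card_children [OF assms(1)] by (auto simp: pair_nodes_def)
  moreover have u: "finite u" "u \<noteq> {}" "u \<subseteq> root_node \<tau>"
    using child_nodes [OF assms(3)] node_finite_nonempty by auto
  moreover have "0 < card u" using u by (simp add: card_gt_0_iff)
  ultimately have "card u = 1" by simp
  then obtain i where "u = {i}" by (auto simp: card_1_singleton_iff)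
  then have "u \<in> leaves \<tau>" using u by (auto simp: leaves_def)
  then show False using assms(3) by (simp add: internal_def)
qed

section \<open>Parents of the nodes in J^-\<close>

lemma ex1_parent:
  assumes "u \<in> internal_minus \<tau>"
  shows "\<exists>!t. t \<in> internal \<tau> \<and> (u = lchild \<tau> t \<or> u = rchild \<tau> t)"
proof -
  have "\<forall>t\<in>nodes \<tau> - {root_node \<tau>}.
      \<exists>!p. p \<in> internal \<tau> \<and> (t = lchild \<tau> p \<or> t = rchild \<tau> p)"
    using tree unfolding dimension_tree_def by (elim conjE)
  moreover have "u \<in> nodes \<tau> - {root_node \<tau>}"
    using assms by (auto simp: internal_minus_def internal_def)
  ultimately show ?thesis by (rule bspec)
qed

lemma parent_unique:
  assumes "u \<in> internal_minus \<tau>" "t \<in> internal \<tau>" "u = lchild \<tau> t \<or> u = rchild \<tau> t"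
    "t' \<in> internal \<tau>" "u = lchild \<tau> t' \<or> u = rchild \<tau> t'"
  shows "t' = t"
  using ex1_parent [OF assms(1)] assms(2-5) by (metis (no_types))

lemma parent_exists:
  assumes "u \<in> internal_minus \<tau>"
  obtains t where "t \<in> internal \<tau>" "u = lchild \<tau> t \<or> u = rchild \<tau> t"
  using ex1_implies_ex [OF ex1_parent [OF assms]] by blast

section \<open>The pairing with infinitesimal actions\<close>

text \<open>For B = \<open>x t\<close> and C = \<open>\<xi> t\<close>, \<open>gram1\<close>,
  \<open>gram2\<close> and \<open>gram12\<close> are the entries of B^(1) (C^(1))^T, B^(2) (C^(2))^T
  and (B^(1,2))^T C^(1,2).\<close>

definition gram1 :: "dims \<Rightarrow> ttn \<Rightarrow> ttn \<Rightarrow> nat set \<Rightarrow> nat \<Rightarrow> nat \<Rightarrow> real" where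
  "gram1 k x \<xi> t p q = (\<Sum>j<k (rchild \<tau> t). \<Sum>l<k t. x t p j l * \<xi> t q j l)"

definition gram2 :: "dims \<Rightarrow> ttn \<Rightarrow> ttn \<Rightarrow> nat set \<Rightarrow> nat \<Rightarrow> nat \<Rightarrow> real" where
  "gram2 k x \<xi> t p q = (\<Sum>i<k (lchild \<tau> t). \<Sum>l<k t. x t i p l * \<xi> t i q l)"

definition gram12 :: "dims \<Rightarrow> ttn \<Rightarrow> ttn \<Rightarrow> nat set \<Rightarrow> nat \<Rightarrow> nat \<Rightarrow> real" where
  "gram12 k x \<xi> t p q = (\<Sum>i<k (lchild \<tau> t). \<Sum>j<k (rchild \<tau> t). x t i j p * \<xi> t i j q)"

text \<open>The sum over \<open>t\<close> has a single nonzero term, at the parent of \<open>u\<close>.\<close>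

definition node_moment :: "dims \<Rightarrow> ttn \<Rightarrow> ttn \<Rightarrow> nat set \<Rightarrow> nat \<Rightarrow> nat \<Rightarrow> real" where
  "node_moment k x \<xi> u p q = gram12 k x \<xi> u p q +
     (\<Sum>t\<in>internal \<tau>. (if lchild \<tau> t = u then gram1 k x \<xi> t p q else 0)
                   + (if rchild \<tau> t = u then gram2 k x \<xi> t p q else 0))"

text \<open>By uniqueness of the parent only the term at \<open>t\<close> survives, and as the two
  children differ, only one of its two summands does.\<close>

lemma node_moment_child:
  assumes "u \<in> internal_minus \<tau>" "t \<in> internal \<tau>"
  shows "u = lchild \<tau> t \<Longrightarrow> node_moment k x \<xi> u p q = gram12 k x \<xi> u p q + gram1 k x \<xi> t p q"
    and "u = rchild \<tau> t \<Longrightarrow> node_moment k x \<xi> u p q = gram12 k x \<xi> u p q + gram2 k x \<xi> t p q"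
proof -
  let ?f = "\<lambda>t. (if lchild \<tau> t = u then gram1 k x \<xi> t p q else 0)
              + (if rchild \<tau> t = u then gram2 k x \<xi> t p q else 0)"
  have one: "sum ?f (internal \<tau>) = ?f t" if "u = lchild \<tau> t \<or> u = rchild \<tau> t"
  proof -
    have "sum ?f (internal \<tau> - {t}) = 0"
    proof (intro sum.neutral ballI)
      fix t' assume "t' \<in> internal \<tau> - {t}"
      then have "lchild \<tau> t' \<noteq> u" "rchild \<tau> t' \<noteq> u"
        using parent_unique [OF assms that, of t'] by auto
      then show "?f t' = 0" by simp
    qed
    then show ?thesis using sum.remove [OF finite_internal assms(2), of ?f] by simp
  qed
  show "node_moment k x \<xi> u p q = gram12 k x \<xi> u p q + gram1 k x \<xi> t p q" if "u = lchild \<tau> t"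
    using one that children_distinct [OF assms(2)] by (simp add: node_moment_def)
  show "node_moment k x \<xi> u p q = gram12 k x \<xi> u p q + gram2 k x \<xi> t p q" if "u = rchild \<tau> t"
    using one that children_distinct [OF assms(2)] by (simp add: node_moment_def)
qed

text \<open>A matrix X^T - Y is symmetric iff X + Y is; here X is \<open>gram12\<close> at a child
  and Y is \<open>gram1\<close> or \<open>gram2\<close> at its parent, so X + Y is the moment of the
  child. Every node of J^- is a child of some node outside L, so the conditions reach all of
  J^-.\<close>

lemma horizontal_iff:
  assumes "\<xi> \<in> tangent_orthogonal \<tau> k x"
  shows "\<xi> \<in> horizontal_space \<tau> k x \<longleftrightarrow>
    (\<forall>u\<in>internal_minus \<tau>. \<forall>p<k u. \<forall>q<k u. node_moment k x \<xi> u p q = node_moment k x \<xi> u q p)"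
    (is "_ \<longleftrightarrow> (\<forall>u\<in>_. ?S u)")
proof -
  have left: "symmetric_matrix
        (transpose_mat (node_matr12 \<tau> k \<xi> (lchild \<tau> t)) * node_matr12 \<tau> k x (lchild \<tau> t)
         - node_matr1 \<tau> k x t * transpose_mat (node_matr1 \<tau> k \<xi> t)) \<longleftrightarrow> ?S (lchild \<tau> t)"
    (is "symmetric_matrix ?M \<longleftrightarrow> _")
    if "t \<in> internal \<tau>" "lchild \<tau> t \<in> internal \<tau>" for t
  proof -
    let ?u = "lchild \<tau> t"
    have car: "?M \<in> carrier_mat (k ?u) (k ?u)"
      by (auto simp: node_matr1_def matr1_def)
    \<comment> \<open>The first product has its factors in the opposite order to
      \<open>gram12\<close>, which swaps \<open>p\<close> and \<open>q\<close>.\<close>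
    have entry: "?M $$ (p, q) = gram12 k x \<xi> ?u q p - gram1 k x \<xi> t p q"
      if "p < k ?u" "q < k ?u" for p q
    proof -
      have "?M $$ (p, q)
          = (transpose_mat (node_matr12 \<tau> k \<xi> ?u) * node_matr12 \<tau> k x ?u) $$ (p, q)
            - (node_matr1 \<tau> k x t * transpose_mat (node_matr1 \<tau> k \<xi> t)) $$ (p, q)"
        using that by (subst index_minus_mat) (auto simp: node_matr1_def matr1_def)
      then show ?thesis
        using that by (simp only: node_matr12_def node_matr1_def matr12_gram_entry
            matr1_gram_entry gram12_def gram1_def mult.commute [of "\<xi> (lchild \<tau> t) _ _ _"])
    qed
    have "?u \<in> internal_minus \<tau>" using internal_child_minus that by blast
    then show ?thesis
      using that(1) unfolding symmetric_matrix_iff [OF car]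
      by (simp add: entry node_moment_child(1) [of _ t] cong: imp_cong) (smt (verit))
  qed
  have right: "symmetric_matrix
        (transpose_mat (node_matr12 \<tau> k \<xi> (rchild \<tau> t)) * node_matr12 \<tau> k x (rchild \<tau> t)
         - node_matr2 \<tau> k x t * transpose_mat (node_matr2 \<tau> k \<xi> t)) \<longleftrightarrow> ?S (rchild \<tau> t)"
    (is "symmetric_matrix ?M \<longleftrightarrow> _")
    if "t \<in> internal \<tau>" "rchild \<tau> t \<in> internal \<tau>" for t
  proof -
    let ?u = "rchild \<tau> t"
    have car: "?M \<in> carrier_mat (k ?u) (k ?u)"
      by (auto simp: node_matr2_def matr2_def)
    have entry: "?M $$ (p, q) = gram12 k x \<xi> ?u q p - gram2 k x \<xi> t p q"
      if "p < k ?u" "q < k ?u" for p q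
    proof -
      have "?M $$ (p, q)
          = (transpose_mat (node_matr12 \<tau> k \<xi> ?u) * node_matr12 \<tau> k x ?u) $$ (p, q)
            - (node_matr2 \<tau> k x t * transpose_mat (node_matr2 \<tau> k \<xi> t)) $$ (p, q)"
        using that by (subst index_minus_mat) (auto simp: node_matr2_def matr2_def)
      then show ?thesis
        using that by (simp only: node_matr12_def node_matr2_def matr12_gram_entry
            matr2_gram_entry gram12_def gram2_def mult.commute [of "\<xi> (rchild \<tau> t) _ _ _"])
    qed
    have "?u \<in> internal_minus \<tau>" using internal_child_minus that by blast
    then show ?thesis
      using that(1) unfolding symmetric_matrix_iff [OF car]
      by (simp add: entry node_moment_child(2) [of _ t] cong: imp_cong) (smt (verit))
  qed
  have "\<xi> \<in> horizontal_space \<tau> k x \<longleftrightarrow>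
      (\<forall>t\<in>internal \<tau> - pair_nodes \<tau>. (lchild \<tau> t \<in> internal \<tau> \<longrightarrow> ?S (lchild \<tau> t)) \<and>
                                   (rchild \<tau> t \<in> internal \<tau> \<longrightarrow> ?S (rchild \<tau> t)))"
    using assms unfolding horizontal_space_def by (simp add: left right del: all_simps)
  also have "\<dots> \<longleftrightarrow> (\<forall>u\<in>internal_minus \<tau>. ?S u)"
  proof
    assume H: "\<forall>t\<in>internal \<tau> - pair_nodes \<tau>. (lchild \<tau> t \<in> internal \<tau> \<longrightarrow> ?S (lchild \<tau> t)) \<and>
                                   (rchild \<tau> t \<in> internal \<tau> \<longrightarrow> ?S (rchild \<tau> t))"
    show "\<forall>u\<in>internal_minus \<tau>. ?S u"
    proof
      fix u assume u: "u \<in> internal_minus \<tau>"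
      then have ui: "u \<in> internal \<tau>" by (simp add: internal_minus_def)
      obtain t where t: "t \<in> internal \<tau>" "u = lchild \<tau> t \<or> u = rchild \<tau> t"
        using parent_exists [OF u] .
      then have "t \<in> internal \<tau> - pair_nodes \<tau>" using internal_child_not_pair ui by blast
      from bspec [OF H this] t(2) ui show "?S u" by blast
    qed
  next
    assume H: "\<forall>u\<in>internal_minus \<tau>. ?S u"
    show "\<forall>t\<in>internal \<tau> - pair_nodes \<tau>. (lchild \<tau> t \<in> internal \<tau> \<longrightarrow> ?S (lchild \<tau> t)) \<and>
                                   (rchild \<tau> t \<in> internal \<tau> \<longrightarrow> ?S (rchild \<tau> t))"
    proof (intro ballI conjI impI)
      fix t assume t: "t \<in> internal \<tau> - pair_nodes \<tau>"
      show "?S (lchild \<tau> t)" if "lchild \<tau> t \<in> internal \<tau>"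
        by (rule bspec [OF H]) (use t that internal_child_minus in blast)
      show "?S (rchild \<tau> t)" if "rchild \<tau> t \<in> internal \<tau>"
        by (rule bspec [OF H]) (use t that internal_child_minus in blast)
    qed
  qed
  finally show ?thesis .
qed

text \<open>In the term for one mode, the coefficient of an entry of \<open>G\<close> is the
  contraction of \<open>x t\<close> with \<open>\<xi> t\<close> over the other two modes. Only
  exchanges of finite sums are involved.\<close>

lemma node_inner_infinitesimal_action:
  assumes "t \<in> internal \<tau>"
  shows "(\<Sum>i<k (lchild \<tau> t). \<Sum>j<k (rchild \<tau> t). \<Sum>l<k t.
            \<xi> t i j l * infinitesimal_action \<tau> k x G t i j l)
    = (\<Sum>p<k (lchild \<tau> t). \<Sum>q<k (lchild \<tau> t). G (lchild \<tau> t) p q * gram1 k x \<xi> t p q)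
    + (\<Sum>p<k (rchild \<tau> t). \<Sum>q<k (rchild \<tau> t). G (rchild \<tau> t) p q * gram2 k x \<xi> t p q)
    + (\<Sum>p<k t. \<Sum>q<k t. G t p q * gram12 k x \<xi> t p q)"
proof -
  let ?n1 = "k (lchild \<tau> t)" and ?n2 = "k (rchild \<tau> t)" and ?n3 = "k t"
  let ?G1 = "G (lchild \<tau> t)" and ?G2 = "G (rchild \<tau> t)" and ?G3 = "G t"
  have 1: "(\<Sum>i<?n1. \<Sum>j<?n2. \<Sum>l<?n3. \<Sum>p<?n1. ?G1 p i * (x t p j l * \<xi> t i j l))
      = (\<Sum>p<?n1. \<Sum>i<?n1. ?G1 p i * gram1 k x \<xi> t p i)"
  proof -
    have "(\<Sum>i<?n1. \<Sum>j<?n2. \<Sum>l<?n3. \<Sum>p<?n1. ?G1 p i * (x t p j l * \<xi> t i j l))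
        = (\<Sum>i<?n1. \<Sum>j<?n2. \<Sum>p<?n1. \<Sum>l<?n3. ?G1 p i * (x t p j l * \<xi> t i j l))"
      by (intro sum.cong refl sum.swap)
    also have "\<dots> = (\<Sum>i<?n1. \<Sum>p<?n1. \<Sum>j<?n2. \<Sum>l<?n3. ?G1 p i * (x t p j l * \<xi> t i j l))"
      by (intro sum.cong refl sum.swap)
    also have "\<dots> = (\<Sum>p<?n1. \<Sum>i<?n1. \<Sum>j<?n2. \<Sum>l<?n3. ?G1 p i * (x t p j l * \<xi> t i j l))"
      by (rule sum.swap)
    finally show ?thesis by (simp add: gram1_def sum_distrib_left)
  qed
  have 2: "(\<Sum>i<?n1. \<Sum>j<?n2. \<Sum>l<?n3. \<Sum>p<?n2. ?G2 p j * (x t i p l * \<xi> t i j l))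
      = (\<Sum>p<?n2. \<Sum>j<?n2. ?G2 p j * gram2 k x \<xi> t p j)"
  proof -
    have "(\<Sum>i<?n1. \<Sum>j<?n2. \<Sum>l<?n3. \<Sum>p<?n2. ?G2 p j * (x t i p l * \<xi> t i j l))
        = (\<Sum>i<?n1. \<Sum>j<?n2. \<Sum>p<?n2. \<Sum>l<?n3. ?G2 p j * (x t i p l * \<xi> t i j l))"
      by (intro sum.cong refl sum.swap)
    also have "\<dots> = (\<Sum>i<?n1. \<Sum>p<?n2. \<Sum>j<?n2. \<Sum>l<?n3. ?G2 p j * (x t i p l * \<xi> t i j l))"
      by (intro sum.cong refl sum.swap)
    also have "\<dots> = (\<Sum>p<?n2. \<Sum>i<?n1. \<Sum>j<?n2. \<Sum>l<?n3. ?G2 p j * (x t i p l * \<xi> t i j l))"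
      by (rule sum.swap)
    also have "\<dots> = (\<Sum>p<?n2. \<Sum>j<?n2. \<Sum>i<?n1. \<Sum>l<?n3. ?G2 p j * (x t i p l * \<xi> t i j l))"
      by (intro sum.cong refl sum.swap)
    finally show ?thesis by (simp add: gram2_def sum_distrib_left)
  qed
  have 3: "(\<Sum>i<?n1. \<Sum>j<?n2. \<Sum>l<?n3. \<Sum>p<?n3. ?G3 p l * (x t i j p * \<xi> t i j l))
      = (\<Sum>p<?n3. \<Sum>l<?n3. ?G3 p l * gram12 k x \<xi> t p l)"
  proof -
    have "(\<Sum>i<?n1. \<Sum>j<?n2. \<Sum>l<?n3. \<Sum>p<?n3. ?G3 p l * (x t i j p * \<xi> t i j l))
        = (\<Sum>i<?n1. \<Sum>l<?n3. \<Sum>j<?n2. \<Sum>p<?n3. ?G3 p l * (x t i j p * \<xi> t i j l))"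
      by (intro sum.cong refl sum.swap)
    also have "\<dots> = (\<Sum>i<?n1. \<Sum>l<?n3. \<Sum>p<?n3. \<Sum>j<?n2. ?G3 p l * (x t i j p * \<xi> t i j l))"
      by (intro sum.cong refl sum.swap)
    also have "\<dots> = (\<Sum>l<?n3. \<Sum>i<?n1. \<Sum>p<?n3. \<Sum>j<?n2. ?G3 p l * (x t i j p * \<xi> t i j l))"
      by (rule sum.swap)
    also have "\<dots> = (\<Sum>l<?n3. \<Sum>p<?n3. \<Sum>i<?n1. \<Sum>j<?n2. ?G3 p l * (x t i j p * \<xi> t i j l))"
      by (intro sum.cong refl sum.swap)
    also have "\<dots> = (\<Sum>p<?n3. \<Sum>l<?n3. \<Sum>i<?n1. \<Sum>j<?n2. ?G3 p l * (x t i j p * \<xi> t i j l))"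
      by (rule sum.swap)
    finally show ?thesis by (simp add: gram12_def sum_distrib_left)
  qed
  have "(\<Sum>i<?n1. \<Sum>j<?n2. \<Sum>l<?n3. \<xi> t i j l * infinitesimal_action \<tau> k x G t i j l)
      = (\<Sum>i<?n1. \<Sum>j<?n2. \<Sum>l<?n3.
           (\<Sum>p<?n1. ?G1 p i * (x t p j l * \<xi> t i j l))
         + (\<Sum>p<?n2. ?G2 p j * (x t i p l * \<xi> t i j l))
         + (\<Sum>p<?n3. ?G3 p l * (x t i j p * \<xi> t i j l)))"
    using assms
    by (intro sum.cong refl)
      (simp add: infinitesimal_action_def in_range_def distrib_left sum_distrib_left mult_ac)
  then show ?thesis by (simp only: sum.distrib 1 2 3)
qed

text \<open>The matrix \<open>G u\<close> enters through the third mode at \<open>u\<close> and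
  through the first or second mode at the parent of \<open>u\<close>. Regrouping the sum over nodes
  by \<open>u\<close> collects its coefficients into the moment.\<close>

lemma inner_infinitesimal_action:
  assumes "\<And>t p q. t \<notin> internal_minus \<tau> \<Longrightarrow> p < k t \<Longrightarrow> q < k t \<Longrightarrow> G t p q = 0"
  shows "ttn_inner \<tau> k \<xi> (infinitesimal_action \<tau> k x G)
    = (\<Sum>u\<in>internal_minus \<tau>. \<Sum>p<k u. \<Sum>q<k u. G u p q * node_moment k x \<xi> u p q)"
proof -
  \<comment> \<open>Being linear in \<open>N\<close>, it distributes over the summands of
    \<open>node_moment\<close>.\<close>
  define pair where "pair u N = (\<Sum>p<k u. \<Sum>q<k u. G u p q * N p q)"
    for u and N :: "nat \<Rightarrow> nat \<Rightarrow> real"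
  have pair_0: "pair u N = 0" if "u \<notin> internal_minus \<tau>" for u N
    using assms that by (simp add: pair_def)
  have fin: "finite (internal_minus \<tau>)" using finite_internal by (simp add: internal_minus_def)
  have pair_moment: "pair u (node_moment k x \<xi> u) = pair u (gram12 k x \<xi> u)
      + (\<Sum>t\<in>internal \<tau>. (if lchild \<tau> t = u then pair u (gram1 k x \<xi> t) else 0)
                     + (if rchild \<tau> t = u then pair u (gram2 k x \<xi> t) else 0))" for u
  proof -
    define f where "f t p q = (if lchild \<tau> t = u then gram1 k x \<xi> t p q else 0)
      + (if rchild \<tau> t = u then gram2 k x \<xi> t p q else 0)" for t p q
    have "(\<Sum>p<k u. \<Sum>q<k u. G u p q * (\<Sum>t\<in>internal \<tau>. f t p q))
        = (\<Sum>p<k u. \<Sum>t\<in>internal \<tau>. \<Sum>q<k u. G u p q * f t p q)"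
      by (subst (2) sum.swap) (simp add: sum_distrib_left)
    also have "\<dots> = (\<Sum>t\<in>internal \<tau>. pair u (f t))"
      by (subst sum.swap) (simp add: pair_def)
    also have "\<dots> = (\<Sum>t\<in>internal \<tau>. (if lchild \<tau> t = u then pair u (gram1 k x \<xi> t) else 0)
                     + (if rchild \<tau> t = u then pair u (gram2 k x \<xi> t) else 0))"
      by (intro sum.cong refl) (simp add: pair_def f_def distrib_left sum.distrib)
    finally show ?thesis
      by (simp add: pair_def node_moment_def f_def distrib_left sum.distrib)
  qed
  have "(\<Sum>u\<in>internal_minus \<tau>. pair u (node_moment k x \<xi> u))
      = (\<Sum>u\<in>internal_minus \<tau>. pair u (gram12 k x \<xi> u))
      + (\<Sum>t\<in>internal \<tau>. \<Sum>u\<in>internal_minus \<tau>.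
            (if lchild \<tau> t = u then pair u (gram1 k x \<xi> t) else 0)
          + (if rchild \<tau> t = u then pair u (gram2 k x \<xi> t) else 0))"
    by (subst sum.swap) (simp add: pair_moment sum.distrib)
  \<comment> \<open>Adding the root to the index set costs nothing, since \<open>G\<close> vanishes
    there.\<close>
  also have "(\<Sum>u\<in>internal_minus \<tau>. pair u (gram12 k x \<xi> u))
      = (\<Sum>t\<in>internal \<tau>. pair t (gram12 k x \<xi> t))"
    using finite_internal pair_0 by (intro sum.mono_neutral_left) (auto simp: internal_minus_def)
  \<comment> \<open>The sum over \<open>u\<close> picks out the child of \<open>t\<close>. If that
    child is a leaf it is not among the \<open>u\<close>, but then its pairing is 0 anyway.\<close>
  also have "(\<Sum>t\<in>internal \<tau>. \<Sum>u\<in>internal_minus \<tau>.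
            (if lchild \<tau> t = u then pair u (gram1 k x \<xi> t) else 0)
          + (if rchild \<tau> t = u then pair u (gram2 k x \<xi> t) else 0))
      = (\<Sum>t\<in>internal \<tau>. pair (lchild \<tau> t) (gram1 k x \<xi> t) + pair (rchild \<tau> t) (gram2 k x \<xi> t))"
    using pair_0 by (intro sum.cong refl) (simp add: sum.distrib fin)
  also have "(\<Sum>t\<in>internal \<tau>. pair t (gram12 k x \<xi> t)) + \<dots>
      = ttn_inner \<tau> k \<xi> (infinitesimal_action \<tau> k x G)"
    unfolding ttn_inner_def pair_def sum.distrib [symmetric]
    by (intro sum.cong refl) (simp add: node_inner_infinitesimal_action)
  finally show ?thesis by (simp add: pair_def)
qed

end

section \<open>Velocities of curves in the orbit\<close>

lemma orthogonal_ttn_columns: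
  assumes "x \<in> orthogonal_ttns \<tau> k" "u \<in> internal_minus \<tau>" "p < k u" "q < k u"
  shows "(\<Sum>i<k (lchild \<tau> u). \<Sum>j<k (rchild \<tau> u). x u i j p * x u i j q) = kron p q"
proof -
  have "transpose_mat (node_matr12 \<tau> k x u) * node_matr12 \<tau> k x u = 1\<^sub>m (k u)"
    using assms(1,2) by (auto simp: orthogonal_ttns_def)
  then have "(transpose_mat (node_matr12 \<tau> k x u) * node_matr12 \<tau> k x u) $$ (p, q) = kron p q"
    using assms(3,4) by simp
  then show ?thesis using assms(3,4) by (simp only: node_matr12_def matr12_gram_entry)
qed

text \<open>Contracting modes 1 and 2 with \<open>A\<close> at the two children cancels their action
  and leaves B_u A_u; multiplication by B_u^T then leaves A_u because B_u^T B_u = I.\<close>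

lemma entry_action_recover:
  assumes x: "x \<in> orthogonal_ttns \<tau> k" and u: "u \<in> internal_minus \<tau>"
    and L: "orthogonal_entries (k (lchild \<tau> u)) (A (lchild \<tau> u))"
    and R: "orthogonal_entries (k (rchild \<tau> u)) (A (rchild \<tau> u))"
    and r: "r < k u" "l < k u"
  shows "A u r l = (\<Sum>i<k (lchild \<tau> u). \<Sum>j<k (rchild \<tau> u). x u i j r *
           (\<Sum>q<k (rchild \<tau> u). A (rchild \<tau> u) j q *
             (\<Sum>p<k (lchild \<tau> u). A (lchild \<tau> u) i p * entry_action \<tau> k x A u p q l)))"
proof -
  let ?n1 = "k (lchild \<tau> u)" and ?n2 = "k (rchild \<tau> u)"
  have ui: "u \<in> internal \<tau>" using u by (simp add: internal_minus_def)
  \<comment> \<open>The entry of B_u A_u in row \<open>(i, j)\<close> and column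
    \<open>l\<close>.\<close>
  define h where "h i j = (\<Sum>r<k u. A u r l * x u i j r)" for i j
  have contract: "(\<Sum>q<?n2. A (rchild \<tau> u) j q *
      (\<Sum>p<?n1. A (lchild \<tau> u) i p * entry_action \<tau> k x A u p q l)) = h i j"
    if "i < ?n1" "j < ?n2" for i j
  proof -
    have "(\<Sum>p<?n1. A (lchild \<tau> u) i p * entry_action \<tau> k x A u p q l)
        = (\<Sum>j'<?n2. A (rchild \<tau> u) j' q * h i j')" if "q < ?n2" for q
    proof -
      have "(\<Sum>p<?n1. A (lchild \<tau> u) i p * entry_action \<tau> k x A u p q l)
          = (\<Sum>p<?n1. A (lchild \<tau> u) i p * (\<Sum>i'<?n1. A (lchild \<tau> u) i' p *
               (\<Sum>j'<?n2. A (rchild \<tau> u) j' q * h i' j')))"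
        using ui that r by (simp add: entry_action_def in_range_def h_def)
      also have "\<dots> = (\<Sum>j'<?n2. A (rchild \<tau> u) j' q * h i j')"
        using L \<open>i < ?n1\<close>
        by (intro sum_orthonormal_rows_contract) (auto simp: orthogonal_entries_def)
      finally show ?thesis .
    qed
    then have "(\<Sum>q<?n2. A (rchild \<tau> u) j q *
        (\<Sum>p<?n1. A (lchild \<tau> u) i p * entry_action \<tau> k x A u p q l))
      = (\<Sum>q<?n2. A (rchild \<tau> u) j q * (\<Sum>j'<?n2. A (rchild \<tau> u) j' q * h i j'))"
      by simp
    also have "\<dots> = h i j"
      using R \<open>j < ?n2\<close>
      by (intro sum_orthonormal_rows_contract) (auto simp: orthogonal_entries_def)
    finally show ?thesis .
  qed
  have "(\<Sum>i<?n1. \<Sum>j<?n2. x u i j r * h i j)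
      = (\<Sum>i<?n1. \<Sum>j<?n2. \<Sum>r'<k u. A u r' l * (x u i j r * x u i j r'))"
    by (simp add: h_def sum_distrib_left mult_ac)
  also have "\<dots> = (\<Sum>i<?n1. \<Sum>r'<k u. \<Sum>j<?n2. A u r' l * (x u i j r * x u i j r'))"
    by (intro sum.cong refl sum.swap)
  also have "\<dots> = (\<Sum>r'<k u. \<Sum>i<?n1. \<Sum>j<?n2. A u r' l * (x u i j r * x u i j r'))"
    by (rule sum.swap)
  also have "\<dots> = (\<Sum>r'<k u. A u r' l * (\<Sum>i<?n1. \<Sum>j<?n2. x u i j r * x u i j r'))"
    by (simp add: sum_distrib_left)
  also have "\<dots> = (\<Sum>r'<k u. kron r r' * A u r' l)"
    using orthogonal_ttn_columns [OF x u r(1)] by (intro sum.cong refl) simp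
  also have "\<dots> = A u r l" using r by simp
  finally show ?thesis by (simp add: contract)
qed

context
  fixes \<tau> :: dim_tree and k :: dims and x :: ttn
  assumes tree: "dimension_tree \<tau>" and x: "x \<in> orthogonal_ttns \<tau> k"
begin

lemma x_in_ttn_space: "x \<in> ttn_space \<tau> k"
  using x by (simp add: orthogonal_ttns_def full_rank_ttns_def)

text \<open>The group elements behind a curve in the orbit are merely chosen, so nothing is known
  beforehand about their dependence on \<open>s\<close>. By induction on the label size,
  \<open>entry_action_recover\<close> writes A_t near 0 as a polynomial in \<open>\<gamma>\<close>
  and in \<open>A\<close> at the children, all differentiable at 0.\<close>

lemma orbit_curve_lift_deriv:
  fixes A :: "real \<Rightarrow> nat set \<Rightarrow> nat \<Rightarrow> nat \<Rightarrow> real"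
  assumes e: "\<epsilon> > 0"
    and ortho: "\<And>s t. t \<in> nodes \<tau> \<Longrightarrow> orthogonal_entries (k t) (A s t)"
    and trivial: "\<And>s t. t \<notin> internal_minus \<tau> \<Longrightarrow> A s t = kron"
    and \<gamma>: "\<And>s. s \<in> {-\<epsilon><..<\<epsilon>} \<Longrightarrow> \<gamma> s = entry_action \<tau> k x (A s)"
    and \<gamma>0: "\<gamma> 0 = x"
    and deriv: "\<And>t i j l. ((\<lambda>s. \<gamma> s t i j l) has_real_derivative \<xi> t i j l) (at 0)"
    and t: "t \<in> nodes \<tau>"
  shows "\<exists>D. \<forall>p<k t. \<forall>q<k t. ((\<lambda>s. A s t p q) has_real_derivative D p q) (at 0) \<and>
           A 0 t p q = kron p q"
  using t
proof (induction "card t" arbitrary: t rule: less_induct)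
  case less
  show ?case
  proof (cases "t \<in> internal_minus \<tau>")
    \<comment> \<open>At a leaf or the root, \<open>A\<close> is constantly the identity.\<close>
    case False
    then show ?thesis using trivial by (intro exI [of _ "\<lambda>_ _. 0"]) simp
  next
    case True
    then have ti: "t \<in> internal \<tau>" by (simp add: internal_minus_def)
    let ?L = "lchild \<tau> t" and ?R = "rchild \<tau> t"
    have nodes: "?L \<in> nodes \<tau>" "?R \<in> nodes \<tau>" using child_nodes [OF tree ti] by auto
    obtain DL where DL: "\<And>p q. p < k ?L \<Longrightarrow> q < k ?L \<Longrightarrow>
        ((\<lambda>s. A s ?L p q) has_real_derivative DL p q) (at 0) \<and> A 0 ?L p q = kron p q"
      using less.hyps [OF card_children(1) [OF tree ti] nodes(1)] by blast
    obtain DR where DR: "\<And>p q. p < k ?R \<Longrightarrow> q < k ?R \<Longrightarrow>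
        ((\<lambda>s. A s ?R p q) has_real_derivative DR p q) (at 0) \<and> A 0 ?R p q = kron p q"
      using less.hyps [OF card_children(2) [OF tree ti] nodes(2)] by blast
    define F where "F s r l = (\<Sum>i<k ?L. \<Sum>j<k ?R. x t i j r *
        (\<Sum>q<k ?R. A s ?R j q * (\<Sum>p<k ?L. A s ?L i p * \<gamma> s t p q l)))" for s r l
    have AF: "A s t r l = F s r l" if "s \<in> {-\<epsilon><..<\<epsilon>}" "r < k t" "l < k t" for s r l
      unfolding F_def \<gamma> [OF that(1)]
      by (rule entry_action_recover [OF x True ortho [OF nodes(1)] ortho [OF nodes(2)] that(2,3)])
    have "\<exists>D. ((\<lambda>s. A s t r l) has_real_derivative D) (at 0)" if r: "r < k t" "l < k t" for r l
    proof -
      have inner: "((\<lambda>s. \<Sum>p<k ?L. A s ?L i p * \<gamma> s t p q l) has_real_derivative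
          (\<Sum>p<k ?L. DL i p * \<gamma> 0 t p q l + A 0 ?L i p * \<xi> t p q l)) (at 0)"
        if "i < k ?L" for i q
        by (rule DERIV_sum_mult) (use DL deriv that in auto)
      define E where "E i j = (\<Sum>q<k ?R. DR j q * (\<Sum>p<k ?L. A 0 ?L i p * \<gamma> 0 t p q l)
          + A 0 ?R j q * (\<Sum>p<k ?L. DL i p * \<gamma> 0 t p q l + A 0 ?L i p * \<xi> t p q l))" for i j
      have outer: "((\<lambda>s. \<Sum>q<k ?R. A s ?R j q * (\<Sum>p<k ?L. A s ?L i p * \<gamma> s t p q l))
          has_real_derivative E i j) (at 0)"
        if "i < k ?L" "j < k ?R" for i j
        unfolding E_def by (rule DERIV_sum_mult) (use DR inner that in auto)
      have "((\<lambda>s. F s r l) has_real_derivative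
          (\<Sum>i<k ?L. \<Sum>j<k ?R. x t i j r * E i j)) (at 0)"
        unfolding F_def by (rule DERIV_sum, rule DERIV_sum, rule DERIV_cmult, rule outer) auto
      \<comment> \<open>\<open>A\<close> and \<open>F\<close> agree on an open interval around 0,
        which suffices for the derivative at 0.\<close>
      then have "((\<lambda>s. A s t r l) has_real_derivative
          (\<Sum>i<k ?L. \<Sum>j<k ?R. x t i j r * E i j)) (at 0)"
        by (rule has_field_derivative_transform_within_open [where S = "{-\<epsilon><..<\<epsilon>}"])
          (use e AF r in auto)
      then show ?thesis ..
    qed
    then obtain D where D: "\<And>r l. r < k t \<Longrightarrow> l < k t \<Longrightarrow>
        ((\<lambda>s. A s t r l) has_real_derivative D r l) (at 0)"
      by metis
    \<comment> \<open>With \<open>\<gamma> 0 = x\<close> and the identity at both children, the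
      formula for A_t reduces to B_t^T B_t = I.\<close>
    have "A 0 t r l = kron r l" if r: "r < k t" "l < k t" for r l
    proof -
      have "A 0 t r l = (\<Sum>i<k ?L. \<Sum>j<k ?R. x t i j r *
          (\<Sum>q<k ?R. kron j q * (\<Sum>p<k ?L. kron i p * x t p q l)))"
        using AF [of 0 r l] e r DL DR \<gamma>0 by (simp add: F_def)
      also have "\<dots> = (\<Sum>i<k ?L. \<Sum>j<k ?R. x t i j r * x t i j l)" by simp
      also have "\<dots> = kron r l" by (rule orthogonal_ttn_columns [OF x True r])
      finally show ?thesis .
    qed
    then show ?thesis using D by blast
  qed
qed

text \<open>The curve lifts to an orthogonal family through the identity, and \<open>G\<close> is
  the velocity of this lift at 0. The chain rule gives the first claim, differentiating A^T A = I
  the last.\<close>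

lemma vertical_is_infinitesimal_action:
  assumes "\<eta> \<in> vertical_space \<tau> k x"
  obtains G where "\<eta> = infinitesimal_action \<tau> k x G"
    and "\<And>t p q. t \<notin> internal_minus \<tau> \<Longrightarrow> G t p q = 0"
    and "\<And>t p q. t \<in> internal_minus \<tau> \<Longrightarrow> p < k t \<Longrightarrow> q < k t \<Longrightarrow> G t p q = - G t q p"
proof -
  obtain \<gamma> \<gamma>' \<epsilon> where e: "\<epsilon> > 0" and \<gamma>0: "\<gamma> 0 = x" and \<gamma>'0: "\<gamma>' 0 = \<eta>"
    and orbit: "\<forall>s\<in>{-\<epsilon><..<\<epsilon>}. \<gamma> s \<in> ttn_orbit \<tau> k x"
    and d: "\<forall>t i j l. (\<forall>s\<in>{-\<epsilon><..<\<epsilon>}. ((\<lambda>r. \<gamma> r t i j l) has_real_derivative \<gamma>' s t i j l) (at s))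
        \<and> continuous_on {-\<epsilon><..<\<epsilon>} (\<lambda>s. \<gamma>' s t i j l)"
    using assms unfolding vertical_space_def tangent_space_def by blast
  have deriv: "((\<lambda>s. \<gamma> s t i j l) has_real_derivative \<eta> t i j l) (at 0)" for t i j l
    using d e \<gamma>'0 by force
  \<comment> \<open>To choose a group element for every real \<open>s\<close>, an arbitrary one is
    taken outside the interval; the group is nonempty because \<open>\<gamma> 0\<close> lies in the
    orbit.\<close>
  have "\<exists>\<A>. \<A> \<in> ttn_group \<tau> k \<and> (s \<in> {-\<epsilon><..<\<epsilon>} \<longrightarrow> \<gamma> s = ttn_action \<tau> k x \<A>)" for s
  proof (cases "s \<in> {-\<epsilon><..<\<epsilon>}")
    case True
    then show ?thesis using orbit by (auto simp: ttn_orbit_def)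
  next
    case False
    have "0 \<in> {-\<epsilon><..<\<epsilon>}" using e by simp
    from bspec [OF orbit this] have "ttn_group \<tau> k \<noteq> {}" by (auto simp: ttn_orbit_def)
    then show ?thesis using False by blast
  qed
  then obtain \<A> where \<A>: "\<And>s. \<A> s \<in> ttn_group \<tau> k"
    and act: "\<And>s. s \<in> {-\<epsilon><..<\<epsilon>} \<Longrightarrow> \<gamma> s = ttn_action \<tau> k x (\<A> s)"
    by metis
  define A where "A s = group_entries \<tau> (\<A> s)" for s
  have group: "\<A> s t \<in> orthogonal_group (k t)" if "t \<in> internal_minus \<tau>" for s t
    using \<A> that by (auto simp: ttn_group_def)
  have ortho: "orthogonal_entries (k t) (A s t)" for s t
  proof (cases "t \<in> internal_minus \<tau>")
    case True
    then have "A s t = (\<lambda>p q. \<A> s t $$ (p, q))" by (intro ext) (simp add: A_def group_entries_def)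
    then show ?thesis using orthogonal_entries_of_group [OF group [OF True]] by simp
  next
    case False
    then have "A s t = kron" by (intro ext) (simp add: A_def group_entries_def)
    then show ?thesis using orthogonal_entries_kron by simp
  qed
  have trivial: "A s t = kron" if "t \<notin> internal_minus \<tau>" for s t
    using that by (intro ext) (simp add: A_def group_entries_def)
  have \<gamma>: "\<gamma> s = entry_action \<tau> k x (A s)" if "s \<in> {-\<epsilon><..<\<epsilon>}" for s
    unfolding act [OF that] A_def
    by (rule ttn_action_eq_entry_action) (use group in \<open>auto simp: orthogonal_group_def\<close>)
  have "\<exists>D. \<forall>p<k t. \<forall>q<k t. ((\<lambda>s. A s t p q) has_real_derivative D p q) (at 0) \<and>
           A 0 t p q = kron p q" if "t \<in> nodes \<tau>" for t
    by (rule orbit_curve_lift_deriv [OF e ortho trivial \<gamma> \<gamma>0 deriv that])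
  then obtain D where D: "\<And>t p q. t \<in> nodes \<tau> \<Longrightarrow> p < k t \<Longrightarrow> q < k t \<Longrightarrow>
      ((\<lambda>s. A s t p q) has_real_derivative D t p q) (at 0) \<and> A 0 t p q = kron p q"
    by metis
  \<comment> \<open>The values of \<open>D\<close> outside the index ranges are arbitrary. At leaves
    and the root the lift is constant, so 0 is its derivative.\<close>
  define G where "G t p q = (if t \<in> internal_minus \<tau> then D t p q else 0)" for t p q
  have G: "((\<lambda>s. A s t p q) has_real_derivative G t p q) (at 0)"
    if "t \<in> nodes \<tau>" "p < k t" "q < k t" for t p q
    using D [OF that] trivial by (cases "t \<in> internal_minus \<tau>") (simp_all add: G_def)
  have "\<eta> = infinitesimal_action \<tau> k x G"
  proof (intro ext)
    fix t i j l
    have "((\<lambda>s. entry_action \<tau> k x (A s) t i j l) has_real_derivative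
        entry_action_deriv \<tau> k x (A 0) G t i j l) (at 0)"
      by (rule DERIV_entry_action [OF G child_nodes [OF tree]])
    moreover have "entry_action_deriv \<tau> k x (A 0) G = infinitesimal_action \<tau> k x G"
      using entry_action_deriv_cong [of \<tau> k "A 0" "\<lambda>t. kron" x G] D child_nodes [OF tree]
      by (simp add: entry_action_deriv_kron)
    ultimately have "((\<lambda>s. entry_action \<tau> k x (A s) t i j l) has_real_derivative
        infinitesimal_action \<tau> k x G t i j l) (at 0)"
      by simp
    then have "((\<lambda>s. \<gamma> s t i j l) has_real_derivative
        infinitesimal_action \<tau> k x G t i j l) (at 0)"
      by (rule has_field_derivative_transform_within_open [where S = "{-\<epsilon><..<\<epsilon>}"])
        (use e \<gamma> in auto)
    then show "\<eta> t i j l = infinitesimal_action \<tau> k x G t i j l"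
      using DERIV_unique deriv by blast
  qed
  moreover have "G t p q = 0" if "t \<notin> internal_minus \<tau>" for t p q
    using that by (simp add: G_def)
  moreover have "G t p q = - G t q p" if t: "t \<in> internal_minus \<tau>" and p: "p < k t" "q < k t" for t p q
  proof -
    have tn: "t \<in> nodes \<tau>" using t by (simp add: internal_minus_def internal_def)
    \<comment> \<open>The derivative of the constant A^T A at 0, where A = I, reads G^T + G =
      0.\<close>
    have "((\<lambda>s. \<Sum>r<k t. A s t r p * A s t r q) has_real_derivative
        (\<Sum>r<k t. G t r p * A 0 t r q + A 0 t r p * G t r q)) (at 0)"
      by (rule DERIV_sum_mult) (use G tn p in auto)
    moreover have "(\<lambda>s. \<Sum>r<k t. A s t r p * A s t r q) = (\<lambda>s. kron p q)"
      using ortho p by (auto simp: orthogonal_entries_def)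
    ultimately have "((\<lambda>s. kron p q) has_real_derivative
        (\<Sum>r<k t. G t r p * A 0 t r q + A 0 t r p * G t r q)) (at 0)"
      by simp
    then have "(\<Sum>r<k t. G t r p * A 0 t r q + A 0 t r p * G t r q) = 0"
      using DERIV_unique DERIV_const by blast
    moreover have "(\<Sum>r<k t. G t r p * A 0 t r q + A 0 t r p * G t r q)
        = (\<Sum>r<k t. kron r q * G t r p) + (\<Sum>r<k t. kron r p * G t r q)"
      using D [OF tn] p by (simp add: sum.distrib mult.commute del: sum_kron_left)
    ultimately show ?thesis using p by simp
  qed
  ultimately show thesis by (rule that)
qed

section \<open>Plane rotations\<close>

text \<open>For distinct \<open>a\<close> and \<open>b\<close>, a Givens rotation: rows
  \<open>a\<close> and \<open>b\<close> carry (cos, sin) and (-sin, cos) in these two columns.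
  Writing it as \<open>kron\<close> plus corrections in two rows lets sums over the row index
  collapse.\<close>

definition plane_rotation :: "nat \<Rightarrow> nat \<Rightarrow> real \<Rightarrow> nat \<Rightarrow> nat \<Rightarrow> real" where
  "plane_rotation a b s p q =
     kron p q + kron p a * ((cos s - 1) * kron a q + sin s * kron b q)
              + kron p b * ((cos s - 1) * kron b q - sin s * kron a q)"

definition plane_rotation_deriv :: "nat \<Rightarrow> nat \<Rightarrow> real \<Rightarrow> nat \<Rightarrow> nat \<Rightarrow> real" where
  "plane_rotation_deriv a b s p q =
     kron p a * (- sin s * kron a q + cos s * kron b q)
   + kron p b * (- sin s * kron b q - cos s * kron a q)"

lemma plane_rotation_in_orthogonal_group:
  assumes "a < n" "b < n" "a \<noteq> b"
  shows "mat n n (\<lambda>(p, q). plane_rotation a b s p q) \<in> orthogonal_group n"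
proof -
  have "(\<Sum>r<n. plane_rotation a b s r p * plane_rotation a b s r q) = kron p q"
    if "p < n" "q < n" for p q
  proof -
    let ?f = "(cos s - 1) * kron a p + sin s * kron b p"
    let ?g = "(cos s - 1) * kron b p - sin s * kron a p"
    let ?P = "plane_rotation a b s"
    \<comment> \<open>Only the first factor is expanded, so the sums collapse at \<open>p\<close>,
      \<open>a\<close> and \<open>b\<close>; what remains is cos^2 + sin^2 = 1.\<close>
    have "(\<Sum>r<n. ?P r p * ?P r q)
        = (\<Sum>r<n. kron r p * ?P r q) + (\<Sum>r<n. kron r a * (?f * ?P r q))
        + (\<Sum>r<n. kron r b * (?g * ?P r q))"
      unfolding sum.distrib [symmetric]
      by (intro sum.cong refl) (simp only: plane_rotation_def [of a b s _ p] distrib_right mult.assoc)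
    also have "\<dots> = ?P p q + ?f * ?P a q + ?g * ?P b q"
      using that assms by (simp only: sum_kron_left if_True)
    also have "\<dots> = kron p q"
      using assms(3) sin_cos_squared_add3 [of s]
      by (auto simp: plane_rotation_def algebra_simps)
    finally show ?thesis .
  qed
  then show ?thesis
    unfolding orthogonal_group_def
    by (auto simp: mat_eq_iff scalar_prod_def atLeast0LessThan)
qed

lemma DERIV_plane_rotation:
  "((\<lambda>s. plane_rotation a b s p q) has_real_derivative plane_rotation_deriv a b s p q) (at s)"
  unfolding plane_rotation_def plane_rotation_deriv_def
  by (auto intro!: derivative_eq_intros)

lemma continuous_on_plane_rotation [continuous_intros]:
  "continuous_on S (\<lambda>s. plane_rotation a b s p q)"
  "continuous_on S (\<lambda>s. plane_rotation_deriv a b s p q)"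
  unfolding plane_rotation_def plane_rotation_deriv_def by (intro continuous_intros)+

text \<open>The elementary skew matrix E_ab - E_ba placed at \<open>u\<close>, the velocity at 0 of
  the plane rotation.\<close>

definition rotation_generator :: "nat set \<Rightarrow> nat \<Rightarrow> nat \<Rightarrow> nat set \<Rightarrow> nat \<Rightarrow> nat \<Rightarrow> real" where
  "rotation_generator u a b t p q =
     (if t = u then kron p a * kron b q - kron p b * kron a q else 0)"

text \<open>Rotating at \<open>u\<close> by the angle \<open>s\<close>, with the identity at all
  other nodes, gives a C^1 curve in the orbit through \<open>x\<close> with this velocity.\<close>

lemma rotation_generator_vertical:
  assumes u: "u \<in> internal_minus \<tau>" and ab: "a < k u" "b < k u" "a \<noteq> b"
  shows "infinitesimal_action \<tau> k x (rotation_generator u a b) \<in> vertical_space \<tau> k x"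
proof -
  \<comment> \<open>The restricted lambda makes the family extensional, as \<open>ttn_group\<close>
    demands.\<close>
  define \<A> where "\<A> s = (\<lambda>t\<in>internal_minus \<tau>.
      if t = u then mat (k u) (k u) (\<lambda>(p, q). plane_rotation a b s p q) else 1\<^sub>m (k t))" for s
  define A where "A s t = (if t = u then plane_rotation a b s else kron)" for s t
  define D where "D s t = (if t = u then plane_rotation_deriv a b s else (\<lambda>_ _. 0))" for s t
  have group: "\<A> s \<in> ttn_group \<tau> k" for s
    using plane_rotation_in_orthogonal_group [OF ab]
    by (auto simp: \<A>_def ttn_group_def orthogonal_group_def)
  have act: "ttn_action \<tau> k x (\<A> s) = entry_action \<tau> k x (A s)" for s
  proof -
    have "ttn_action \<tau> k x (\<A> s) = entry_action \<tau> k x (group_entries \<tau> (\<A> s))"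
      by (rule ttn_action_eq_entry_action) (auto simp: \<A>_def)
    also have "\<dots> = entry_action \<tau> k x (A s)"
    proof -
      \<comment> \<open>The two families need to agree only inside the ranges \<open>k t\<close>,
        since \<open>entry_action\<close> reads no other entries.\<close>
      have "group_entries \<tau> (\<A> s) t p q = A s t p q" if "p < k t" "q < k t" for t p q
        using that u by (auto simp: group_entries_def \<A>_def A_def)
      then show ?thesis
        by (intro ext) (simp add: entry_action_def in_range_def cong: sum.cong_simp)
    qed
    finally show ?thesis .
  qed
  have A_deriv: "((\<lambda>s. A s t p q) has_real_derivative D s t p q) (at s)" for s t p q
    by (cases "t = u") (simp_all add: A_def D_def DERIV_plane_rotation)
  have A_cont: "continuous_on S (\<lambda>s. A s t p q)" "continuous_on S (\<lambda>s. D s t p q)" for S t p q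
    by (cases "t = u"; simp add: A_def D_def continuous_intros)+
  have A0: "A 0 = (\<lambda>t. kron)"
    by (intro ext) (simp add: A_def plane_rotation_def)
  have D0: "D 0 = rotation_generator u a b"
    by (intro ext) (simp add: D_def plane_rotation_deriv_def rotation_generator_def)
  show ?thesis
    unfolding vertical_space_def tangent_space_def mem_Collect_eq
  proof (intro exI conjI ballI allI)
    \<comment> \<open>The curve is defined for all \<open>s\<close>, so any radius would
      serve.\<close>
    show "(1::real) > 0" by simp
    show "entry_action \<tau> k x (A 0) = x"
      by (simp only: A0 entry_action_kron [OF x_in_ttn_space])
    show "entry_action_deriv \<tau> k x (A 0) (D 0)
        = infinitesimal_action \<tau> k x (rotation_generator u a b)"
      by (simp only: A0 D0 entry_action_deriv_kron)
    show "entry_action \<tau> k x (A s) \<in> ttn_orbit \<tau> k x" for s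
      unfolding ttn_orbit_def using act group by (metis (mono_tags, lifting) mem_Collect_eq)
    show "((\<lambda>r. entry_action \<tau> k x (A r) t i j l) has_real_derivative
        entry_action_deriv \<tau> k x (A s) (D s) t i j l) (at s)" for s t i j l
      by (rule DERIV_entry_action [OF A_deriv child_nodes [OF tree]])
    show "continuous_on {- 1<..<1} (\<lambda>s. entry_action_deriv \<tau> k x (A s) (D s) t i j l)" for t i j l
      unfolding entry_action_deriv_def
      by (cases "in_range \<tau> k t i j l") (simp_all only: if_True if_False,
          intro continuous_intros A_cont, intro continuous_intros)
  qed
qed

text \<open>The generator has the entries 1 at \<open>(a, b)\<close> and -1 at
  \<open>(b, a)\<close>, so it measures the asymmetry of the moment in this pair of indices.\<close>

lemma rotation_generator_pairing:
  assumes u: "u \<in> internal_minus \<tau>" and ab: "a < k u" "b < k u"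
  shows "ttn_inner \<tau> k \<xi> (infinitesimal_action \<tau> k x (rotation_generator u a b))
       = node_moment \<tau> k x \<xi> u a b - node_moment \<tau> k x \<xi> u b a"
proof -
  let ?N = "node_moment \<tau> k x \<xi>" and ?G = "rotation_generator u a b"
  have fin: "finite (internal_minus \<tau>)"
    using finite_internal [OF tree] by (simp add: internal_minus_def)
  have "ttn_inner \<tau> k \<xi> (infinitesimal_action \<tau> k x ?G)
      = (\<Sum>t\<in>internal_minus \<tau>. \<Sum>p<k t. \<Sum>q<k t. ?G t p q * ?N t p q)"
    by (rule inner_infinitesimal_action [OF tree]) (use u in \<open>auto simp: rotation_generator_def\<close>)
  also have "\<dots> = (\<Sum>t\<in>internal_minus \<tau>.
      if t = u then \<Sum>p<k u. \<Sum>q<k u. ?G u p q * ?N u p q else 0)"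
    by (intro sum.cong refl) (simp add: rotation_generator_def)
  also have "\<dots> = (\<Sum>p<k u. \<Sum>q<k u. ?G u p q * ?N u p q)"
    using u fin by simp
  also have "\<dots> = (\<Sum>p<k u. kron p a * (\<Sum>q<k u. kron b q * ?N u p q))
      - (\<Sum>p<k u. kron p b * (\<Sum>q<k u. kron a q * ?N u p q))"
    unfolding sum_subtractf [symmetric] sum_distrib_left
    by (intro sum.cong refl)
      (simp only: rotation_generator_def simp_thms if_True left_diff_distrib mult.assoc)
  also have "\<dots> = ?N u a b - ?N u b a"
    using ab by (simp only: sum_kron_left if_True)
  finally show ?thesis .
qed

end

theorem proposition3p6:
  fixes \<tau> :: dim_tree and k :: "nat set \<Rightarrow> nat" and x :: "nat set \<Rightarrow> tensor3"
  assumes "dimension_tree \<tau>"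
    and "\<forall>t\<in>nodes \<tau>. k t > 0"
    and "x \<in> orthogonal_ttns \<tau> k"
  shows "horizontal_space \<tau> k x =
         orthogonal_complement_in \<tau> k (tangent_orthogonal \<tau> k x) (vertical_space \<tau> k x)"
proof -
  note tree = assms(1) and x = assms(3)
  have "\<xi> \<in> horizontal_space \<tau> k x \<longleftrightarrow> (\<forall>\<eta>\<in>vertical_space \<tau> k x. ttn_inner \<tau> k \<xi> \<eta> = 0)"
    if \<xi>: "\<xi> \<in> tangent_orthogonal \<tau> k x" for \<xi>
    unfolding horizontal_iff [OF tree \<xi>]
  proof (intro iffI ballI allI impI)
    \<comment> \<open>Horizontal implies orthogonal: a skew \<open>G\<close> pairs to 0 with
      symmetric moments.\<close>
    fix \<eta>
    assume sym: "\<forall>u\<in>internal_minus \<tau>. \<forall>p<k u. \<forall>q<k u.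
        node_moment \<tau> k x \<xi> u p q = node_moment \<tau> k x \<xi> u q p"
      and \<eta>: "\<eta> \<in> vertical_space \<tau> k x"
    obtain G where G: "\<eta> = infinitesimal_action \<tau> k x G"
      and G_0: "\<And>t p q. t \<notin> internal_minus \<tau> \<Longrightarrow> G t p q = 0"
      and G_skew: "\<And>t p q. t \<in> internal_minus \<tau> \<Longrightarrow> p < k t \<Longrightarrow> q < k t \<Longrightarrow> G t p q = - G t q p"
      by (rule vertical_is_infinitesimal_action [OF tree x \<eta>]) (rule that)
    have "ttn_inner \<tau> k \<xi> \<eta>
        = (\<Sum>u\<in>internal_minus \<tau>. \<Sum>p<k u. \<Sum>q<k u. G u p q * node_moment \<tau> k x \<xi> u p q)"
      unfolding G by (rule inner_infinitesimal_action [OF tree G_0])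
    also have "\<dots> = 0"
    proof (rule sum.neutral, rule ballI, rule skew_pairing_symmetric_zero)
      fix u p q assume u: "u \<in> internal_minus \<tau>" and pq: "p < k u" "q < k u"
      show "G u p q = - G u q p" by (rule G_skew [OF u pq])
      show "node_moment \<tau> k x \<xi> u p q = node_moment \<tau> k x \<xi> u q p" using sym u pq by blast
    qed
    finally show "ttn_inner \<tau> k \<xi> \<eta> = 0" .
  next
    \<comment> \<open>Conversely, it suffices to test orthogonality against the rotation
      generators.\<close>
    fix u a b
    assume orth: "\<forall>\<eta>\<in>vertical_space \<tau> k x. ttn_inner \<tau> k \<xi> \<eta> = 0"
      and u: "u \<in> internal_minus \<tau>" "a < k u" "b < k u"
    show "node_moment \<tau> k x \<xi> u a b = node_moment \<tau> k x \<xi> u b a"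
    \<comment> \<open>A rotation needs two distinct axes; on the diagonal the claim is
      trivial.\<close>
    proof (cases "a = b")
      case False
      then show ?thesis
        using orth rotation_generator_vertical [OF tree x u False]
          rotation_generator_pairing [OF tree x u, of \<xi>] by simp
    qed simp
  qed
  moreover have "horizontal_space \<tau> k x \<subseteq> tangent_orthogonal \<tau> k x"
    by (auto simp only: horizontal_space_def)
  ultimately show ?thesis
    unfolding orthogonal_complement_in_def by blast
qed

end
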